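(* Let $\{A_j\}_{j\in\mathbb J}$ and $\{B_j\}_{j\in\mathbb J}$ be two operator-valued frames with $A_j\in B(H_A,H_o)$ and $B_j\in B(H_B,H_o)$ for all $j\in\mathbb J$, and let $H_{\mathbb J}:=\ell^2(\mathbb J)\otimes H_o$. Then the two frames are: (i) disjoint if and only if $P_AH_{\mathbb J}\cap P_BH_{\mathbb J}=\{0\}$ and $P_AH_{\mathbb J}+P_BH_{\mathbb J}$ is closed; (ii) strongly disjoint if and only if $P_AP_B=0$, if and only if $\theta_A^*\theta_B=0$, if and only if $\theta_B^*\theta_A=0$; (iii) strongly complementary if and only if $P_A+P_B=I\otimes I_o$.
   Context: $H_A,H_B,H_o$ are Hilbert spaces, $\mathbb J$ an index set; $I,I_o$ are the identities of $\ell^2(\mathbb J)$ and $H_o$. A family $\{C_j\}_{j\in\mathbb J}\subset B(H,H_o)$ is an operator-valued frame on $H$ if $S_C:=\sum_jC_j^*C_j$ converges strongly (net of finite partial sums) to a bounded positive invertible operator; Parseval if $S_C=I$. Its analysis operator is $\theta_C:=\sum_jL_jC_j\in B(H,\ell^2(\mathbb J)\otimes H_o)$ (strong convergence), where $L_jh=e_j\otimes h$, and its frame projection is $P_C:=\theta_CS_C^{-1}\theta_C^*$, the range projection of $\theta_C$. A frame is orthonormal if it is Parseval and $\theta_C\theta_C^*=I\otimes I_o$. For $A_j\in B(H_A,H_o)$, $B_j\in B(H_B,H_o)$, the operator $A_j\oplus B_j\in B(H_A\oplus H_B,H_o)$ is $(A_j\oplus B_j)(x\oplus y)=A_jx+B_jy$.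 The two frames are called: disjoint if $\{A_j\oplus B_j\}_{j}$ is an operator-valued frame on $H_A\oplus H_B$; strongly disjoint (or orthogonal) if there are invertible operators $T_A\in B(H_A)$, $T_B\in B(H_B)$ such that $\{A_jT_A\oplus B_jT_B\}_{j}$ is a Parseval operator-valued frame on $H_A\oplus H_B$; strongly complementary if there are invertible operators $T_A\in B(H_A)$, $T_B\in B(H_B)$ such that $\{A_jT_A\oplus B_jT_B\}_{j}$ is an orthonormal operator-valued frame on $H_A\oplus H_B$. *)

theory Defs
  imports "HOL-Analysis.Analysis"
begin

section \<open>Complex Hilbert spaces\<close>

text \<open>
  The complex inner product is linear in the first argument.  The norm, the topology and the
  positive definiteness come from the underlying real inner product space, whose inner product is
  the real part of the complex one.
\<close>

class complex_hilbert = real_inner + complete_space +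
  fixes scaleC :: "complex \<Rightarrow> 'a \<Rightarrow> 'a" (infixr \<open>*\<^sub>C\<close> 75)
    and cinner :: "'a \<Rightarrow> 'a \<Rightarrow> complex"
  assumes scaleC_add_right: "a *\<^sub>C (x + y) = a *\<^sub>C x + a *\<^sub>C y"
    and scaleC_add_left: "(a + b) *\<^sub>C x = a *\<^sub>C x + b *\<^sub>C x"
    and scaleC_scaleC: "a *\<^sub>C b *\<^sub>C x = (a * b) *\<^sub>C x"
    and scaleC_of_real: "complex_of_real r *\<^sub>C x = r *\<^sub>R x"
    and cinner_commute: "cinner x y = cnj (cinner y x)"
    and cinner_add_left: "cinner (x + y) z = cinner x z + cinner y z"
    and cinner_scaleC_left: "cinner (a *\<^sub>C x) y = a * cinner x y"
    and Re_cinner: "Re (cinner x y) = inner x y"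

instantiation complex :: complex_hilbert
begin

definition scaleC_complex :: "complex \<Rightarrow> complex \<Rightarrow> complex"
  where "scaleC_complex a x = a * x"

definition cinner_complex :: "complex \<Rightarrow> complex \<Rightarrow> complex"
  where "cinner_complex x y = x * cnj y"

instance
  by standard
    (auto simp: scaleC_complex_def cinner_complex_def algebra_simps scaleR_conv_of_real
      inner_complex_def)

end

text \<open>The product type is the Hilbert space direct sum.\<close>

instantiation prod :: (complex_hilbert, complex_hilbert) complex_hilbert
begin

definition scaleC_prod :: "complex \<Rightarrow> 'a \<times> 'b \<Rightarrow> 'a \<times> 'b"
  where "scaleC_prod a x = (a *\<^sub>C fst x, a *\<^sub>C snd x)"

definition cinner_prod :: "'a \<times> 'b \<Rightarrow> 'a \<times> 'b \<Rightarrow> complex"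
  where "cinner_prod x y = cinner (fst x) (fst y) + cinner (snd x) (snd y)"

instance
proof
  fix x y :: "'a \<times> 'b"
  show "cinner x y = cnj (cinner y x)"
    unfolding cinner_prod_def by (metis cinner_commute complex_cnj_add)
qed (auto simp: scaleC_prod_def cinner_prod_def algebra_simps scaleC_add_right scaleC_add_left
      scaleC_scaleC scaleC_of_real cinner_add_left cinner_scaleC_left Re_cinner inner_prod_def
      prod_eq_iff)

end

lemma cinner_add_right: "cinner x (y + z) = cinner x y + cinner x z"
  for x :: "'a::complex_hilbert"
  by (metis cinner_add_left cinner_commute complex_cnj_add)

lemma cinner_scaleC_right: "cinner x (a *\<^sub>C y) = cnj a * cinner x y"
  for x :: "'a::complex_hilbert"
  by (metis cinner_scaleC_left cinner_commute complex_cnj_mult)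

lemma cinner_self: "cinner x x = complex_of_real ((norm x)\<^sup>2)"
  for x :: "'a::complex_hilbert"
proof (rule complex_eqI)
  show "Re (cinner x x) = Re (complex_of_real ((norm x)\<^sup>2))"
    by (simp add: Re_cinner power2_norm_eq_inner)
  have "Im (cinner x x) = - Im (cinner x x)"
    by (metis cinner_commute cnj.sel(2))
  then show "Im (cinner x x) = Im (complex_of_real ((norm x)\<^sup>2))"
    by simp
qed

lemma norm_scaleC: "norm (a *\<^sub>C x) = cmod a * norm x"
  for x :: "'a::complex_hilbert"
proof -
  have "complex_of_real ((norm (a *\<^sub>C x))\<^sup>2) = a * cnj a * cinner x x"
    by (simp only: cinner_self [symmetric] cinner_scaleC_left cinner_scaleC_right mult_ac)
  also have "\<dots> = complex_of_real ((cmod a * norm x)\<^sup>2)"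
    by (simp only: cinner_self complex_norm_square [symmetric] power_mult_distrib of_real_mult)
  finally have "(norm (a *\<^sub>C x))\<^sup>2 = (cmod a * norm x)\<^sup>2"
    using of_real_eq_iff by blast
  then show ?thesis
    by (rule power2_eq_imp_eq) auto
qed

lemma Im_cinner: "Im (cinner x y) = inner x (\<i> *\<^sub>C y)"
  for x :: "'a::complex_hilbert"
  by (simp add: Re_cinner [symmetric] cinner_scaleC_right)

lemma norm_cinner_le: "cmod (cinner x y) \<le> 2 * (norm x * norm y)"
  for x :: "'a::complex_hilbert"
proof -
  have "cmod (cinner x y) \<le> \<bar>Re (cinner x y)\<bar> + \<bar>Im (cinner x y)\<bar>"
    by (rule cmod_le)
  also have "\<dots> \<le> norm x * norm y + norm x * norm (\<i> *\<^sub>C y)"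
    unfolding Re_cinner Im_cinner by (intro add_mono Cauchy_Schwarz_ineq2)
  finally show ?thesis
    by (simp add: norm_scaleC)
qed


section \<open>The Hilbert spaces of square-summable families\<close>

definition square_summable :: "('j \<Rightarrow> 'o::real_normed_vector) \<Rightarrow> bool"
  where "square_summable f \<longleftrightarrow> (\<lambda>j. (norm (f j))\<^sup>2) summable_on UNIV"

lemma square_summable_add:
  assumes "square_summable f" "square_summable g"
  shows "square_summable (\<lambda>j. f j + g j)"
  unfolding square_summable_def
proof (rule summable_on_comparison_test)
  show "(\<lambda>j. 2 * (norm (f j))\<^sup>2 + 2 * (norm (g j))\<^sup>2) summable_on UNIV"
    using assms unfolding square_summable_def
    by (intro summable_on_add summable_on_cmult_right)
  fix j
  have "(norm (f j + g j))\<^sup>2 \<le> (norm (f j) + norm (g j))\<^sup>2"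
    by (intro power_mono norm_triangle_ineq) auto
  also have "\<dots> \<le> 2 * (norm (f j))\<^sup>2 + 2 * (norm (g j))\<^sup>2"
    using sum_squares_bound [of "norm (f j)" "norm (g j)"] by (simp add: power2_sum)
  finally show "(norm (f j + g j))\<^sup>2 \<le> 2 * (norm (f j))\<^sup>2 + 2 * (norm (g j))\<^sup>2" .
qed auto

lemma square_summable_scaled:
  assumes "square_summable f" "\<And>j. norm (g j) = c * norm (f j)"
  shows "square_summable g"
  using assms unfolding square_summable_def
  by (auto simp: power_mult_distrib intro: summable_on_cmult_right)

lemma square_summable_product:
  assumes "square_summable f" "square_summable g"
  shows "(\<lambda>j. norm (f j) * norm (g j)) summable_on UNIV"
proof (rule summable_on_comparison_test)
  show "(\<lambda>j. (norm (f j))\<^sup>2 + (norm (g j))\<^sup>2) summable_on UNIV"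
    using assms unfolding square_summable_def by (intro summable_on_add)
  show "norm (f j) * norm (g j) \<le> (norm (f j))\<^sup>2 + (norm (g j))\<^sup>2" for j
    using sum_squares_bound [of "norm (f j)" "norm (g j)"]
      mult_nonneg_nonneg [OF norm_ge_zero [of "f j"] norm_ge_zero [of "g j"]] by linarith
qed auto

lemma square_summable_inner:
  fixes f g :: "'j \<Rightarrow> 'o::real_inner"
  assumes "square_summable f" "square_summable g"
  shows "(\<lambda>j. inner (f j) (g j)) summable_on UNIV"
proof (rule abs_summable_summable, rule Infinite_Sum.abs_summable_on_comparison_test')
  show "(\<lambda>j. norm (f j) * norm (g j)) summable_on UNIV"
    by (rule square_summable_product [OF assms])
  show "norm (inner (f j) (g j)) \<le> norm (f j) * norm (g j)" for j
    by (simp add: Cauchy_Schwarz_ineq2)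
qed

lemma square_summable_cinner:
  fixes f g :: "'j \<Rightarrow> 'o::complex_hilbert"
  assumes "square_summable f" "square_summable g"
  shows "(\<lambda>j. cinner (f j) (g j)) summable_on UNIV"
proof (rule abs_summable_summable, rule Infinite_Sum.abs_summable_on_comparison_test')
  show "(\<lambda>j. 2 * (norm (f j) * norm (g j))) summable_on UNIV"
    by (intro summable_on_cmult_right square_summable_product [OF assms])
  show "norm (cinner (f j) (g j)) \<le> 2 * (norm (f j) * norm (g j))" for j
    by (rule norm_cinner_le)
qed

typedef (overloaded) ('j, 'o) ell2 = "{f :: 'j \<Rightarrow> 'o::real_normed_vector. square_summable f}"
  morphisms coord Abs_ell2
  by (rule exI [of _ "\<lambda>_. 0"]) (simp add: square_summable_def)

setup_lifting type_definition_ell2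

lemma square_summable_coord: "square_summable (coord f)"
  using coord [of f] by simp

lemma ell2_eqI: "(\<And>j. coord f j = coord g j) \<Longrightarrow> f = g"
  by (metis coord_inject ext)

instantiation ell2 :: (type, real_inner) real_inner
begin

lift_definition zero_ell2 :: "('a, 'b) ell2" is "\<lambda>_. 0"
  by (simp add: square_summable_def)

lift_definition plus_ell2 :: "('a, 'b) ell2 \<Rightarrow> ('a, 'b) ell2 \<Rightarrow> ('a, 'b) ell2"
  is "\<lambda>f g j. f j + g j"
  by (rule square_summable_add)

lift_definition uminus_ell2 :: "('a, 'b) ell2 \<Rightarrow> ('a, 'b) ell2" is "\<lambda>f j. - f j"
  by (simp add: square_summable_def)

lift_definition minus_ell2 :: "('a, 'b) ell2 \<Rightarrow> ('a, 'b) ell2 \<Rightarrow> ('a, 'b) ell2"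
  is "\<lambda>f g j. f j - g j"
  subgoal for f g
    using square_summable_add [of f "\<lambda>j. - g j"] by (simp add: square_summable_def)
  done

lift_definition scaleR_ell2 :: "real \<Rightarrow> ('a, 'b) ell2 \<Rightarrow> ('a, 'b) ell2"
  is "\<lambda>r f j. r *\<^sub>R f j"
  by (erule square_summable_scaled) (rule norm_scaleR)

lift_definition inner_ell2 :: "('a, 'b) ell2 \<Rightarrow> ('a, 'b) ell2 \<Rightarrow> real"
  is "\<lambda>f g. \<Sum>\<^sub>\<infinity>j. inner (f j) (g j)" .

definition norm_ell2 :: "('a, 'b) ell2 \<Rightarrow> real"
  where "norm_ell2 f = sqrt (inner f f)"

definition dist_ell2 :: "('a, 'b) ell2 \<Rightarrow> ('a, 'b) ell2 \<Rightarrow> real"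
  where "dist_ell2 f g = norm (f - g)"

definition sgn_ell2 :: "('a, 'b) ell2 \<Rightarrow> ('a, 'b) ell2"
  where "sgn_ell2 f = inverse (norm f) *\<^sub>R f"

definition uniformity_ell2 :: "(('a, 'b) ell2 \<times> ('a, 'b) ell2) filter"
  where "uniformity_ell2 = (INF e\<in>{0 <..}. principal {(f, g). dist f g < e})"

definition open_ell2 :: "('a, 'b) ell2 set \<Rightarrow> bool"
  where "open_ell2 U \<longleftrightarrow>
    (\<forall>f\<in>U. eventually (\<lambda>(f', g). f' = f \<longrightarrow> g \<in> U) uniformity)"

instance
proof
  fix f g h :: "('a, 'b) ell2" and r s :: real
  show "f + g + h = f + (g + h)" by transfer (simp add: add.assoc)
  show "f + g = g + f" by transfer (simp add: add.commute)
  show "0 + f = f" by transfer simp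
  show "- f + f = 0" by transfer simp
  show "f - g = f + - g" by transfer simp
  show "r *\<^sub>R (f + g) = r *\<^sub>R f + r *\<^sub>R g" by transfer (simp add: scaleR_add_right)
  show "(r + s) *\<^sub>R f = r *\<^sub>R f + s *\<^sub>R f" by transfer (simp add: scaleR_add_left)
  show "r *\<^sub>R s *\<^sub>R f = (r * s) *\<^sub>R f" by transfer simp
  show "1 *\<^sub>R f = f" by transfer simp
  show "dist f g = norm (f - g)" by (rule dist_ell2_def)
  show "sgn f = inverse (norm f) *\<^sub>R f" by (rule sgn_ell2_def)
  show "norm f = sqrt (inner f f)" by (rule norm_ell2_def)
  show "uniformity = (INF e\<in>{0 <..}. principal {(f, g :: ('a, 'b) ell2). dist f g < e})"
    by (rule uniformity_ell2_def)
  show "inner f g = inner g f" by transfer (simp add: inner_commute)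
  show "inner (f + g) h = inner f h + inner g h"
    by transfer (simp add: inner_add_left infsum_add square_summable_inner)
  show "inner (r *\<^sub>R f) g = r * inner f g"
    by transfer (simp add: infsum_cmult_right')
  show "0 \<le> inner f f"
    by transfer (simp add: infsum_nonneg)
  show "inner f f = 0 \<longleftrightarrow> f = 0"
  proof transfer
    fix f :: "'a \<Rightarrow> 'b"
    assume f: "square_summable f"
    show "(\<Sum>\<^sub>\<infinity>j. inner (f j) (f j)) = 0 \<longleftrightarrow> f = (\<lambda>_. 0)"
    proof
      assume *: "(\<Sum>\<^sub>\<infinity>j. inner (f j) (f j)) = 0"
      have "inner (f j) (f j) = 0" for j
        by (rule nonneg_infsum_le_0D [where A = UNIV and f = "\<lambda>j. inner (f j) (f j)"])
          (use * square_summable_inner [OF f f] in auto)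
      then show "f = (\<lambda>_. 0)" by auto
    qed simp
  qed
next
  fix U :: "('a, 'b) ell2 set"
  show "open U = (\<forall>f\<in>U. \<forall>\<^sub>F (f', g) in uniformity. f' = f \<longrightarrow> g \<in> U)"
    by (rule open_ell2_def)
qed

end

lemma norm_ell2_square: "(norm f)\<^sup>2 = (\<Sum>\<^sub>\<infinity>j. (norm (coord f j))\<^sup>2)"
  for f :: "('j, 'o::real_inner) ell2"
  by (simp add: power2_norm_eq_inner inner_ell2.rep_eq)

lemma sum_norm_coord_le: "finite F \<Longrightarrow> (\<Sum>j\<in>F. (norm (coord f j))\<^sup>2) \<le> (norm f)\<^sup>2"
  for f :: "('j, 'o::real_inner) ell2"
  unfolding norm_ell2_square
  by (rule finite_sum_le_infsum) (use square_summable_coord [of f] in \<open>auto simp: square_summable_def\<close>)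

lemma norm_coord_le: "norm (coord f j) \<le> norm f"
  for f :: "('j, 'o::real_inner) ell2"
  using sum_norm_coord_le [of "{j}" f] by simp

instance ell2 :: (type, "{real_inner, complete_space}") complete_space
proof
  fix X :: "nat \<Rightarrow> ('a, 'b) ell2"
  assume "Cauchy X"
  have "convergent (\<lambda>n. coord (X n) j)" for j
  proof (rule Cauchy_convergent, rule CauchyI)
    fix e :: real
    assume "e > 0"
    then obtain M where "\<forall>m\<ge>M. \<forall>n\<ge>M. norm (X m - X n) < e"
      using \<open>Cauchy X\<close> unfolding Cauchy_iff by blast
    moreover have "norm (coord (X m) j - coord (X n) j) \<le> norm (X m - X n)" for m n
      using norm_coord_le [of "X m - X n" j] by (simp add: minus_ell2.rep_eq)
    ultimately show "\<exists>M. \<forall>m\<ge>M. \<forall>n\<ge>M. norm (coord (X m) j - coord (X n) j) < e"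
      by (meson le_less_trans)
  qed
  then obtain f where f: "(\<lambda>n. coord (X n) j) \<longlonglongrightarrow> f j" for j
    unfolding convergent_def by metis
  have bound: "(\<Sum>j\<in>F. (norm (coord (X m) j - f j))\<^sup>2) \<le> e\<^sup>2"
    if M: "\<forall>m\<ge>M. \<forall>n\<ge>M. norm (X m - X n) < e" and "m \<ge> M" "finite F" for M m e F
  proof (rule LIMSEQ_le_const2)
    show "(\<lambda>n. \<Sum>j\<in>F. (norm (coord (X m) j - coord (X n) j))\<^sup>2)
        \<longlonglongrightarrow> (\<Sum>j\<in>F. (norm (coord (X m) j - f j))\<^sup>2)"
      by (intro tendsto_intros f)
    have "(\<Sum>j\<in>F. (norm (coord (X m) j - coord (X n) j))\<^sup>2) \<le> e\<^sup>2" if "n \<ge> M" for n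
    proof -
      have "(\<Sum>j\<in>F. (norm (coord (X m) j - coord (X n) j))\<^sup>2) \<le> (norm (X m - X n))\<^sup>2"
        using sum_norm_coord_le [OF \<open>finite F\<close>, of "X m - X n"] by (simp add: minus_ell2.rep_eq)
      also have "\<dots> \<le> e\<^sup>2"
        using M \<open>m \<ge> M\<close> that by (intro power_mono) (auto intro: less_imp_le)
      finally show ?thesis .
    qed
    then show "\<exists>N. \<forall>n\<ge>N. (\<Sum>j\<in>F. (norm (coord (X m) j - coord (X n) j))\<^sup>2) \<le> e\<^sup>2"
      by blast
  qed
  have diff: "square_summable (\<lambda>j. coord (X m) j - f j)"
    if "\<forall>m\<ge>M. \<forall>n\<ge>M. norm (X m - X n) < e" "m \<ge> M" for M m e
    unfolding square_summable_def
    by (rule nonneg_bdd_above_summable_on) (use bound [OF that] in \<open>auto intro!: bdd_aboveI2\<close>)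
  obtain M where "\<forall>m\<ge>M. \<forall>n\<ge>M. norm (X m - X n) < 1"
    using \<open>Cauchy X\<close> unfolding Cauchy_iff by (meson zero_less_one)
  from diff [OF this order_refl] have "square_summable (\<lambda>j. f j - coord (X M) j)"
    by (simp add: square_summable_def norm_minus_commute)
  from square_summable_add [OF this square_summable_coord [of "X M"]]
  have "square_summable f" by simp
  then have coord_f: "coord (Abs_ell2 f) = f"
    by (simp add: Abs_ell2_inverse)
  have "X \<longlonglongrightarrow> Abs_ell2 f"
  proof (rule LIMSEQ_I)
    fix e :: real
    assume "e > 0"
    then obtain M where M: "\<forall>m\<ge>M. \<forall>n\<ge>M. norm (X m - X n) < e / 2"
      using \<open>Cauchy X\<close> unfolding Cauchy_iff by (meson half_gt_zero)
    have "norm (X m - Abs_ell2 f) < e" if "m \<ge> M" for m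
    proof -
      have "(norm (X m - Abs_ell2 f))\<^sup>2 \<le> (e / 2)\<^sup>2"
        unfolding norm_ell2_square minus_ell2.rep_eq coord_f
        by (rule infsum_le_finite_sums)
          (use bound [OF M that] diff [OF M that] in \<open>auto simp: square_summable_def\<close>)
      then have "norm (X m - Abs_ell2 f) \<le> e / 2"
        by (rule power2_le_imp_le) (use \<open>e > 0\<close> in simp)
      then show ?thesis using \<open>e > 0\<close> by simp
    qed
    then show "\<exists>M. \<forall>m\<ge>M. norm (X m - Abs_ell2 f) < e" by blast
  qed
  then show "convergent X" by (rule convergentI)
qed

instantiation ell2 :: (type, complex_hilbert) complex_hilbert
begin

lift_definition scaleC_ell2 :: "complex \<Rightarrow> ('a, 'b) ell2 \<Rightarrow> ('a, 'b) ell2"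
  is "\<lambda>a f j. a *\<^sub>C f j"
  by (erule square_summable_scaled) (rule norm_scaleC)

lift_definition cinner_ell2 :: "('a, 'b) ell2 \<Rightarrow> ('a, 'b) ell2 \<Rightarrow> complex"
  is "\<lambda>f g. \<Sum>\<^sub>\<infinity>j. cinner (f j) (g j)" .

instance
proof
  fix f g h :: "('a, 'b) ell2" and a b :: complex and r :: real
  show "a *\<^sub>C (f + g) = a *\<^sub>C f + a *\<^sub>C g" by transfer (simp add: scaleC_add_right)
  show "(a + b) *\<^sub>C f = a *\<^sub>C f + b *\<^sub>C f" by transfer (simp add: scaleC_add_left)
  show "a *\<^sub>C b *\<^sub>C f = (a * b) *\<^sub>C f" by transfer (simp add: scaleC_scaleC)
  show "complex_of_real r *\<^sub>C f = r *\<^sub>R f" by transfer (simp add: scaleC_of_real)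
  show "cinner f g = cnj (cinner g f)"
    by transfer (simp flip: infsum_cnj cinner_commute)
  show "cinner (f + g) h = cinner f h + cinner g h"
    by transfer (simp add: cinner_add_left infsum_add square_summable_cinner)
  show "cinner (a *\<^sub>C f) g = a * cinner f g"
    by transfer (simp add: cinner_scaleC_left infsum_cmult_right')
  show "Re (cinner f g) = inner f g"
    by transfer (simp add: square_summable_cinner Re_cinner flip: infsum_Re)
qed

end


section \<open>The tensor product of the scalar sequence space with a Hilbert space\<close>

text \<open>
  The space of square-summable scalar families on the index type \<open>'j\<close> is \<open>('j, complex) ell2\<close>.
  Its Hilbert space tensor product with \<open>'o\<close> is realised as \<open>('j, 'o) ell2\<close>.  The lemmas
  below state the characterising properties of the tensor product: elementary tensors are
  bilinear, the inner product is multiplicative on them, and they span a dense subspace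
  (the real span is the complex one, since elementary tensors are closed under complex scaling).
\<close>

lift_definition ell2_basis :: "'j \<Rightarrow> ('j, complex) ell2" is "\<lambda>j i. if i = j then 1 else 0"
proof -
  fix j :: 'j
  have "(\<lambda>i. (norm (if i = j then 1 else 0 :: complex))\<^sup>2) summable_on UNIV"
    by (rule has_sum_imp_summable, rule has_sum_finite_neutralI [of "{j}"]) auto
  then show "square_summable (\<lambda>i. if i = j then 1 else 0 :: complex)"
    by (simp add: square_summable_def)
qed

lift_definition tensor :: "('j, complex) ell2 \<Rightarrow> 'o::complex_hilbert \<Rightarrow> ('j, 'o) ell2"
    (infixr \<open>\<otimes>\<^sub>\<ell>\<close> 70)
  is "\<lambda>a h j. a j *\<^sub>C h"
  subgoal for a h
    by (rule square_summable_scaled [where f = a and c = "norm h"]) (auto simp: norm_scaleC)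
  done

lemma tensor_add_left: "(a + b) \<otimes>\<^sub>\<ell> h = a \<otimes>\<^sub>\<ell> h + b \<otimes>\<^sub>\<ell> h"
  by transfer (simp add: scaleC_add_left)

lemma tensor_add_right: "a \<otimes>\<^sub>\<ell> (h + k) = a \<otimes>\<^sub>\<ell> h + a \<otimes>\<^sub>\<ell> k"
  by transfer (simp add: scaleC_add_right)

lemma tensor_scaleC_left: "(c *\<^sub>C a) \<otimes>\<^sub>\<ell> h = c *\<^sub>C (a \<otimes>\<^sub>\<ell> h)"
  by transfer (simp add: scaleC_scaleC scaleC_complex_def)

lemma tensor_scaleC_right: "a \<otimes>\<^sub>\<ell> (c *\<^sub>C h) = c *\<^sub>C (a \<otimes>\<^sub>\<ell> h)"
  by transfer (simp add: scaleC_scaleC mult.commute)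

lemma cinner_tensor: "cinner (a \<otimes>\<^sub>\<ell> h) (b \<otimes>\<^sub>\<ell> k) = cinner a b * cinner h k"
proof transfer
  fix a b :: "'a \<Rightarrow> complex" and h k :: 'b
  have "cinner (a j *\<^sub>C h) (b j *\<^sub>C k) = cinner (a j) (b j) * cinner h k" for j
    by (simp add: cinner_scaleC_left cinner_scaleC_right cinner_complex_def)
  then show "(\<Sum>\<^sub>\<infinity>j. cinner (a j *\<^sub>C h) (b j *\<^sub>C k)) =
      (\<Sum>\<^sub>\<infinity>j. cinner (a j) (b j)) * cinner h k"
    by (simp add: infsum_cmult_left')
qed

lemma coord_sum: "coord (sum f F) j = (\<Sum>i\<in>F. coord (f i) j)"
  by (induction F rule: infinite_finite_induct) (auto simp: zero_ell2.rep_eq plus_ell2.rep_eq)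

lemma has_sum_basis_tensor:
  "((\<lambda>j. ell2_basis j \<otimes>\<^sub>\<ell> coord f j) has_sum f) UNIV"
  for f :: "('j, 'o::complex_hilbert) ell2"
proof -
  let ?S = "\<lambda>F. \<Sum>j\<in>F. ell2_basis j \<otimes>\<^sub>\<ell> coord f j"
  have zero: "0 *\<^sub>C x = 0" and one: "1 *\<^sub>C x = x" for x :: 'o
    using scaleC_of_real [of 0 x] scaleC_of_real [of 1 x] by simp_all
  have c: "coord (?S F) i = (if i \<in> F then coord f i else 0)" if "finite F" for F i
  proof -
    have "coord (?S F) i = (\<Sum>j\<in>F. if i = j then coord f i else 0)"
      unfolding coord_sum
      by (intro sum.cong) (auto simp: tensor.rep_eq ell2_basis.rep_eq zero one)
    then show ?thesis using that by simp
  qed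
  have sm: "(\<lambda>j. (norm (coord f j))\<^sup>2) summable_on UNIV"
    using square_summable_coord [of f] by (simp add: square_summable_def)
  have d: "(norm (?S F - f))\<^sup>2 = (norm f)\<^sup>2 - (\<Sum>j\<in>F. (norm (coord f j))\<^sup>2)" if "finite F" for F
  proof -
    have fs: "((\<lambda>j. - (if j \<in> F then (norm (coord f j))\<^sup>2 else 0)) has_sum
        - (\<Sum>j\<in>F. (norm (coord f j))\<^sup>2)) UNIV"
      by (rule has_sum_finite_neutralI [of F]) (use that in \<open>auto simp: sum_negf\<close>)
    have "(norm (?S F - f))\<^sup>2 =
        (\<Sum>\<^sub>\<infinity>j. (norm (coord f j))\<^sup>2 - (if j \<in> F then (norm (coord f j))\<^sup>2 else 0))"
      unfolding norm_ell2_square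
      by (intro infsum_cong) (simp add: minus_ell2.rep_eq c [OF that])
    also have "\<dots> = (norm f)\<^sup>2 - (\<Sum>j\<in>F. (norm (coord f j))\<^sup>2)"
      using infsumI [OF has_sum_add [OF has_sum_infsum [OF sm] fs]]
      by (simp add: norm_ell2_square)
    finally show ?thesis .
  qed
  have "((\<lambda>F. \<Sum>j\<in>F. (norm (coord f j))\<^sup>2) \<longlongrightarrow> (norm f)\<^sup>2) (finite_subsets_at_top UNIV)"
    using has_sum_infsum [OF sm] by (simp add: has_sum_def norm_ell2_square)
  then have "((\<lambda>F. sqrt ((norm f)\<^sup>2 - (\<Sum>j\<in>F. (norm (coord f j))\<^sup>2))) \<longlongrightarrow> sqrt ((norm f)\<^sup>2 - (norm f)\<^sup>2))
      (finite_subsets_at_top UNIV)"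
    by (intro tendsto_intros)
  moreover have "\<forall>\<^sub>F F in finite_subsets_at_top UNIV.
      sqrt ((norm f)\<^sup>2 - (\<Sum>j\<in>F. (norm (coord f j))\<^sup>2)) = norm (?S F - f)"
    by (rule eventually_finite_subsets_at_top_weakI) (simp flip: d)
  ultimately have "((\<lambda>F. norm (?S F - f)) \<longlongrightarrow> sqrt ((norm f)\<^sup>2 - (norm f)\<^sup>2))
      (finite_subsets_at_top UNIV)"
    by (rule Lim_transform_eventually)
  then have "((\<lambda>F. ?S F - f) \<longlongrightarrow> 0) (finite_subsets_at_top UNIV)"
    by (simp add: tendsto_norm_zero_iff)
  then show ?thesis
    unfolding has_sum_def by (rule LIM_zero_cancel)
qed

lemma tensor_total:
  "closure (span (range (\<lambda>(a, h). a \<otimes>\<^sub>\<ell> h))) = (UNIV :: ('j, 'o::complex_hilbert) ell2 set)"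
proof -
  have "f \<in> closure (span (range (\<lambda>(a, h). a \<otimes>\<^sub>\<ell> h)))" for f :: "('j, 'o) ell2"
  proof (rule Lim_in_closed_set [OF closed_closure _ finite_subsets_at_top_neq_bot])
    show "((\<lambda>F. \<Sum>j\<in>F. ell2_basis j \<otimes>\<^sub>\<ell> coord f j) \<longlongrightarrow> f) (finite_subsets_at_top UNIV)"
      using has_sum_basis_tensor [of f] by (simp add: has_sum_def)
    have "(\<Sum>j\<in>F. ell2_basis j \<otimes>\<^sub>\<ell> coord f j) \<in> span (range (\<lambda>(a, h). a \<otimes>\<^sub>\<ell> h))" for F
      by (intro span_sum span_base) auto
    then show "\<forall>\<^sub>F F in finite_subsets_at_top UNIV.
        (\<Sum>j\<in>F. ell2_basis j \<otimes>\<^sub>\<ell> coord f j) \<in> closure (span (range (\<lambda>(a, h). a \<otimes>\<^sub>\<ell> h)))"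
      using closure_subset by (intro always_eventually allI) blast
  qed
  then show ?thesis by blast
qed


section \<open>Bounded operators\<close>

text \<open>
  Operators are plain functions; membership in the space of bounded operators is the predicate
  \<open>bounded_clinear\<close>.  For such operators \<open>cadjoint\<close> is the Hilbert space adjoint, as the
  defining equation has exactly one solution; it carries no meaning for other functions.
\<close>

definition bounded_clinear :: "('a::complex_hilbert \<Rightarrow> 'b::complex_hilbert) \<Rightarrow> bool"
  where "bounded_clinear T \<longleftrightarrow> bounded_linear T \<and> (\<forall>c x. T (c *\<^sub>C x) = c *\<^sub>C T x)"

definition cadjoint ::
    "('a::complex_hilbert \<Rightarrow> 'b::complex_hilbert) \<Rightarrow> 'b \<Rightarrow> 'a"
  where "cadjoint T = (SOME S. \<forall>x y. cinner (T x) y = cinner x (S y))"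

definition positive_op :: "('a::complex_hilbert \<Rightarrow> 'a) \<Rightarrow> bool"
  where "positive_op T \<longleftrightarrow> (\<forall>x. cinner (T x) x \<in> \<real>\<^sub>\<ge>\<^sub>0)"

definition invertible_op :: "('a::complex_hilbert \<Rightarrow> 'a) \<Rightarrow> bool"
  where "invertible_op T \<longleftrightarrow>
    bounded_clinear T \<and> (\<exists>S. bounded_clinear S \<and> S \<circ> T = id \<and> T \<circ> S = id)"


section \<open>Operator-valued frames\<close>

text \<open>
  The unordered sums \<open>summable_on\<close> and \<open>\<Sum>\<^sub>\<infinity>\<close> are limits of the net of finite partial sums, so
  pointwise sums express strong convergence.
\<close>

definition frame_operator ::
    "('j \<Rightarrow> 'a::complex_hilbert \<Rightarrow> 'o::complex_hilbert) \<Rightarrow> 'a \<Rightarrow> 'a"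
  where "frame_operator C x = (\<Sum>\<^sub>\<infinity>j. cadjoint (C j) (C j x))"

definition ov_frame :: "('j \<Rightarrow> 'a::complex_hilbert \<Rightarrow> 'o::complex_hilbert) \<Rightarrow> bool"
  where "ov_frame C \<longleftrightarrow>
    (\<forall>j. bounded_clinear (C j)) \<and>
    (\<forall>x. (\<lambda>j. cadjoint (C j) (C j x)) summable_on UNIV) \<and>
    bounded_clinear (frame_operator C) \<and> positive_op (frame_operator C) \<and>
    invertible_op (frame_operator C)"

definition parseval_frame :: "('j \<Rightarrow> 'a::complex_hilbert \<Rightarrow> 'o::complex_hilbert) \<Rightarrow> bool"
  where "parseval_frame C \<longleftrightarrow> ov_frame C \<and> frame_operator C = id"

definition L_op :: "'j \<Rightarrow> 'o::complex_hilbert \<Rightarrow> ('j, 'o) ell2"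
  where "L_op j h = ell2_basis j \<otimes>\<^sub>\<ell> h"

definition analysis_operator ::
    "('j \<Rightarrow> 'a::complex_hilbert \<Rightarrow> 'o::complex_hilbert) \<Rightarrow> 'a \<Rightarrow> ('j, 'o) ell2"
  where "analysis_operator C x = (\<Sum>\<^sub>\<infinity>j. L_op j (C j x))"

definition frame_projection ::
    "('j \<Rightarrow> 'a::complex_hilbert \<Rightarrow> 'o::complex_hilbert) \<Rightarrow> ('j, 'o) ell2 \<Rightarrow> ('j, 'o) ell2"
  where "frame_projection C =
    analysis_operator C \<circ> inv (frame_operator C) \<circ> cadjoint (analysis_operator C)"

definition orthonormal_frame :: "('j \<Rightarrow> 'a::complex_hilbert \<Rightarrow> 'o::complex_hilbert) \<Rightarrow> bool"
  where "orthonormal_frame C \<longleftrightarrow>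
    parseval_frame C \<and> analysis_operator C \<circ> cadjoint (analysis_operator C) = id"

definition op_dsum :: "('a \<Rightarrow> 'o::complex_hilbert) \<Rightarrow> ('b \<Rightarrow> 'o) \<Rightarrow> 'a \<times> 'b \<Rightarrow> 'o"
    (infixr \<open>\<oplus>\<^sub>o\<close> 65)
  where "(S \<oplus>\<^sub>o T) z = S (fst z) + T (snd z)"

definition disjoint_frames ::
    "('j \<Rightarrow> 'a::complex_hilbert \<Rightarrow> 'o::complex_hilbert) \<Rightarrow> ('j \<Rightarrow> 'b::complex_hilbert \<Rightarrow> 'o) \<Rightarrow> bool"
  where "disjoint_frames A B \<longleftrightarrow> ov_frame (\<lambda>j. A j \<oplus>\<^sub>o B j)"

definition strongly_disjoint_frames ::
    "('j \<Rightarrow> 'a::complex_hilbert \<Rightarrow> 'o::complex_hilbert) \<Rightarrow> ('j \<Rightarrow> 'b::complex_hilbert \<Rightarrow> 'o) \<Rightarrow> bool"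
  where "strongly_disjoint_frames A B \<longleftrightarrow>
    (\<exists>T\<^sub>A T\<^sub>B. invertible_op T\<^sub>A \<and> invertible_op T\<^sub>B \<and>
      parseval_frame (\<lambda>j. (A j \<circ> T\<^sub>A) \<oplus>\<^sub>o (B j \<circ> T\<^sub>B)))"

definition strongly_complementary_frames ::
    "('j \<Rightarrow> 'a::complex_hilbert \<Rightarrow> 'o::complex_hilbert) \<Rightarrow> ('j \<Rightarrow> 'b::complex_hilbert \<Rightarrow> 'o) \<Rightarrow> bool"
  where "strongly_complementary_frames A B \<longleftrightarrow>
    (\<exists>T\<^sub>A T\<^sub>B. invertible_op T\<^sub>A \<and> invertible_op T\<^sub>B \<and>
      orthonormal_frame (\<lambda>j. (A j \<circ> T\<^sub>A) \<oplus>\<^sub>o (B j \<circ> T\<^sub>B)))"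

end

theory Submission
  imports Defs
begin

text \<open>
  Everything is read off from the analysis operators \<open>\<alpha>\<close> and \<open>\<beta>\<close> of the two frames.  A family
  \<open>C\<close> of operators that are the components of a bounded operator \<open>\<theta>\<close> into the square-summable
  families has analysis operator \<open>\<theta>\<close> and frame operator \<open>S = \<theta>\<^sup>* \<theta>\<close>.  Hence it is a frame iff
  \<open>\<theta>\<close> is bounded below (\<open>ov_frame_iff_bounded_below\<close>), Parseval iff \<open>\<theta>\<close> is isometric
  (\<open>parseval_frame_iff_isometric\<close>) and orthonormal iff \<open>\<theta>\<close> is moreover surjective
  (\<open>orthonormal_frame_iff_unitary\<close>).  The frame projection has the range of \<open>\<theta>\<close> and the kernel of
  \<open>\<theta>\<^sup>*\<close>.  The family \<open>A j T \<oplus> B j U\<close> is analysed by \<open>W (x, y) = \<alpha> (T x) + \<beta> (U y)\<close>.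

  For disjointness, take \<open>T\<close> and \<open>U\<close> to be identities.  By completeness and Baire's theorem,
  \<open>W\<close> is bounded below iff it is injective with closed range
  (\<open>injective_closed_range_bounded_below\<close>).  As \<open>\<alpha>\<close> and \<open>\<beta>\<close> are injective, injectivity
  of \<open>W\<close> says that their ranges meet only in \<open>0\<close>; and the range of \<open>W\<close> is the sum of their
  ranges.

  For strong disjointness, an isometric \<open>W\<close> maps the two summands to orthogonal subspaces, which are
  the ranges of \<open>\<alpha>\<close> and \<open>\<beta>\<close>.  Conversely, if these ranges are orthogonal, the choice of
  \<open>T = S\<^sup>-\<^sup>1\<^sup>/\<^sup>2\<close> for each of the frame operators makes \<open>W\<close> isometric.  Such an operator is
  provided by \<open>coercive_normalizer\<close>, where the square root is a fixed point of a contraction.  Strong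
  complementarity asks in addition that \<open>W\<close> be surjective, that is, that the two orthogonal ranges
  span the whole space; this is what \<open>P\<^sub>A + P\<^sub>B = I\<close> says.
\<close>

section \<open>Bounded operators and adjoints\<close>

text \<open>This inclusion gives access to the completeness of the operator norm.\<close>

instance complex_hilbert \<subseteq> banach ..

lemma cinner_zero_left [simp]: "cinner 0 x = 0"
  for x :: "'a::complex_hilbert"
  using cinner_add_left [of 0 0 x] by simp

lemma cinner_zero_right [simp]: "cinner x 0 = 0"
  for x :: "'a::complex_hilbert"
  using cinner_add_right [of x 0 0] by simp

lemma scaleC_scaleR: "a *\<^sub>C (r *\<^sub>R x) = r *\<^sub>R (a *\<^sub>C x)"
  for x :: "'a::complex_hilbert"
  by (simp add: scaleC_scaleC mult.commute flip: scaleC_of_real)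

lemma scaleC_diff_right: "a *\<^sub>C (x - y) = a *\<^sub>C x - a *\<^sub>C y"
  for x :: "'a::complex_hilbert"
  using scaleC_add_right [of a "x - y" y] by (simp add: algebra_simps)

lemma scaleC_zero_right [simp]: "a *\<^sub>C 0 = 0"
  for a :: complex
  using scaleC_diff_right [of a 0 0] by simp

lemma cinner_eqI:
  fixes x y :: "'a::complex_hilbert"
  assumes "\<And>z. cinner z x = cinner z y"
  shows "x = y"
proof -
  have "inner z x = inner z y" for z
    using assms [of z] by (metis Re_cinner)
  then have "inner (x - y) (x - y) = 0"
    by (simp add: inner_diff_right)
  then show ?thesis by simp
qed

lemma bounded_clinear_bounded_linear: "bounded_clinear T \<Longrightarrow> bounded_linear T"
  by (simp add: bounded_clinear_def)

lemma bounded_clinear_add: "bounded_clinear T \<Longrightarrow> T (x + y) = T x + T y"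
  by (simp add: bounded_clinear_def bounded_linear.linear linear_add)

lemma bounded_clinear_diff: "bounded_clinear T \<Longrightarrow> T (x - y) = T x - T y"
  by (simp add: bounded_clinear_def bounded_linear.linear linear_diff)

lemma bounded_clinear_zero: "bounded_clinear T \<Longrightarrow> T 0 = 0"
  by (simp add: bounded_clinear_def bounded_linear.linear linear_0)

lemma bounded_clinear_scaleC: "bounded_clinear T \<Longrightarrow> T (c *\<^sub>C x) = c *\<^sub>C T x"
  by (simp add: bounded_clinear_def)

lemma bounded_clinear_compose:
  "bounded_clinear S \<Longrightarrow> bounded_clinear T \<Longrightarrow> bounded_clinear (\<lambda>x. S (T x))"
  by (simp add: bounded_clinear_def bounded_linear_compose)

text \<open>
  The Riesz representation of a bounded functional \<open>f\<close>.  The representing vector is the minimiser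
  of the quadratic functional \<open>\<parallel>x\<parallel>\<^sup>2 / 2 - f x\<close>: it exists because the parallelogram law makes
  minimising sequences Cauchy, and the first variation at a minimiser gives the representation.
\<close>

lemma riesz_representation:
  fixes f :: "'a::{real_inner, complete_space} \<Rightarrow> real"
  assumes "bounded_linear f"
  shows "\<exists>z. \<forall>x. f x = inner x z"
proof -
  interpret f: bounded_linear f by (rule assms)
  obtain K where K: "\<And>x. norm (f x) \<le> norm x * K"
    using f.bounded by blast
  define J where "J x = (norm x)\<^sup>2 / 2 - f x" for x
  have lower: "- (K\<^sup>2 / 2) \<le> J x" for x
  proof -
    have "f x \<le> norm x * K" using K [of x] by simp
    moreover have "0 \<le> (norm x - K)\<^sup>2" by simp
    ultimately show ?thesis by (simp add: J_def power2_diff)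
  qed
  have bdd: "bdd_below (range J)"
    by (rule bdd_belowI2 [where m = "- (K\<^sup>2 / 2)"]) (rule lower)
  define d where "d = Inf (range J)"
  have d_le: "d \<le> J x" for x
    unfolding d_def by (rule cInf_lower [OF _ bdd]) simp
  have "\<exists>x. J x < d + inverse (real (Suc n))" for n
    using cInf_lessD [of "range J" "d + inverse (real (Suc n))"] by (auto simp: d_def)
  then obtain X where X: "J (X n) < d + inverse (real (Suc n))" for n
    by metis
  have para: "(norm (x - y))\<^sup>2 \<le> 4 * (J x + J y - 2 * d)" for x y
  proof -
    have "J ((1/2) *\<^sub>R (x + y)) = (J x + J y) / 2 - (norm (x - y))\<^sup>2 / 8"
      by (simp add: J_def f.scaleR f.add power2_norm_eq_inner inner_add_left inner_add_right
          inner_diff_left inner_diff_right inner_commute field_simps)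
    then show ?thesis using d_le [of "(1/2) *\<^sub>R (x + y)"] by argo
  qed
  have "Cauchy X"
  proof (rule CauchyI)
    fix e :: real assume "e > 0"
    then obtain N where N: "inverse (real (Suc N)) < e\<^sup>2 / 8"
      using reals_Archimedean [of "e\<^sup>2 / 8"] by auto
    have "norm (X m - X n) < e" if "m \<ge> N" "n \<ge> N" for m n
    proof -
      have "inverse (real (Suc m)) \<le> inverse (real (Suc N))"
        "inverse (real (Suc n)) \<le> inverse (real (Suc N))"
        using that by (simp_all add: le_imp_inverse_le)
      then have "(norm (X m - X n))\<^sup>2 < e\<^sup>2"
        using para [of "X m" "X n"] X [of m] X [of n] N by argo
      then show ?thesis using \<open>e > 0\<close> by (simp add: power_less_imp_less_base)
    qed
    then show "\<exists>N. \<forall>m\<ge>N. \<forall>n\<ge>N. norm (X m - X n) < e" by blast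
  qed
  then obtain z where z: "X \<longlonglongrightarrow> z"
    using Cauchy_convergent_iff convergent_def by blast
  have "(\<lambda>n. J (X n)) \<longlonglongrightarrow> J z"
    unfolding J_def by (intro tendsto_intros z f.tendsto) auto
  moreover have "(\<lambda>n. d + inverse (real (Suc n))) \<longlonglongrightarrow> d + 0"
    by (intro tendsto_intros LIMSEQ_inverse_real_of_nat)
  ultimately have Jz: "J z \<le> d"
    using X by (intro LIMSEQ_le [of "\<lambda>n. J (X n)" _ "\<lambda>n. d + inverse (real (Suc n))"])
      (auto intro: less_imp_le)
  have "f x = inner x z" for x
  proof (rule ccontr)
    assume neq: "f x \<noteq> inner x z"
    define a where "a = inner x z - f x"
    define N where "N = (norm x)\<^sup>2 + 1"
    have N: "N > 0" by (simp add: N_def add_nonneg_pos)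
    have var: "0 \<le> t * a + t\<^sup>2 * (norm x)\<^sup>2 / 2" for t
    proof -
      have "J (z + t *\<^sub>R x) = J z + (t * a + t\<^sup>2 * (norm x)\<^sup>2 / 2)"
        unfolding J_def a_def f.add f.scaleR power2_norm_eq_inner
        by (simp add: inner_add_left inner_add_right inner_commute field_simps power2_eq_square)
      then show ?thesis using d_le [of "z + t *\<^sub>R x"] Jz by simp
    qed
    \<comment> \<open>Decreasing along \<open>x\<close> with this step length would go below the minimum.\<close>
    have "0 \<le> (- a / N) * a + (- a / N)\<^sup>2 * (norm x)\<^sup>2 / 2" by (rule var)
    also have "\<dots> \<le> (- a / N) * a + (- a / N)\<^sup>2 * N / 2"
      by (intro add_left_mono divide_right_mono mult_left_mono) (auto simp: N_def)
    also have "\<dots> = - (a\<^sup>2 / (2 * N))"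
      using N by (simp add: field_simps power2_eq_square)
    finally have "a\<^sup>2 / (2 * N) \<le> 0" by simp
    moreover have "a\<^sup>2 / (2 * N) > 0"
      using neq N by (simp add: a_def)
    ultimately show False by simp
  qed
  then show ?thesis by blast
qed

text \<open>
  A functional of the form \<open>x \<mapsto> \<langle>T x, y\<rangle>\<close> is complex-linear, so it is determined by its real part.
  The equality may thus be checked on real inner products.
\<close>

lemma cinner_of_inner:
  assumes T: "bounded_clinear T" and S: "\<And>x. inner (T x) y = inner x z"
  shows "cinner (T x) y = cinner x z"
proof (rule complex_eqI)
  show "Re (cinner (T x) y) = Re (cinner x z)"
    by (simp add: Re_cinner S)
  have Im: "Im (cinner u v) = - inner (\<i> *\<^sub>C u) v" for u v :: "'c::complex_hilbert"
    by (simp add: Re_cinner [symmetric] cinner_scaleC_left)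
  show "Im (cinner (T x) y) = Im (cinner x z)"
    unfolding Im by (simp flip: S bounded_clinear_scaleC [OF T])
qed

lemma cinner_cadjoint:
  assumes T: "bounded_clinear T"
  shows "cinner (T x) y = cinner x (cadjoint T y)"
proof -
  have "\<exists>z. \<forall>x. cinner (T x) y = cinner x z" for y
  proof -
    have "bounded_linear (\<lambda>x. inner (T x) y)"
      by (rule bounded_linear_compose [OF bounded_linear_inner_left
            bounded_clinear_bounded_linear [OF T]])
    from riesz_representation [OF this] show ?thesis
      using cinner_of_inner [OF T] by metis
  qed
  then have "\<exists>S. \<forall>x y. cinner (T x) y = cinner x (S y)" by metis
  then have "\<forall>x y. cinner (T x) y = cinner x (cadjoint T y)"
    unfolding cadjoint_def by (rule someI_ex)
  then show ?thesis by blast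
qed

lemma cinner_cadjoint_left:
  assumes "bounded_clinear T"
  shows "cinner (cadjoint T y) x = cinner y (T x)"
  using cinner_cadjoint [OF assms] by (metis cinner_commute)

lemma bounded_clinear_cadjoint:
  assumes T: "bounded_clinear T"
  shows "bounded_clinear (cadjoint T)"
proof -
  note adj = cinner_cadjoint [OF T, symmetric]
  have add: "cadjoint T (x + y) = cadjoint T x + cadjoint T y" for x y
    by (rule cinner_eqI) (simp add: adj cinner_add_right)
  have scale: "cadjoint T (c *\<^sub>C x) = c *\<^sub>C cadjoint T x" for c x
    by (rule cinner_eqI) (simp add: adj cinner_scaleC_right)
  obtain K where K: "K > 0" "\<And>x. norm (T x) \<le> norm x * K"
    using bounded_linear.pos_bounded [OF bounded_clinear_bounded_linear [OF T]] by blast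
  have "norm (cadjoint T y) \<le> norm y * K" for y
  proof (cases "cadjoint T y = 0")
    case True
    then show ?thesis using K(1) by simp
  next
    case False
    have "norm (cadjoint T y) * norm (cadjoint T y) = inner (cadjoint T y) (cadjoint T y)"
      by (simp add: power2_norm_eq_inner flip: power2_eq_square)
    also have "\<dots> = inner (T (cadjoint T y)) y"
      by (metis adj Re_cinner)
    also have "\<dots> \<le> norm (T (cadjoint T y)) * norm y"
      by (rule norm_cauchy_schwarz)
    also have "\<dots> \<le> (norm (cadjoint T y) * K) * norm y"
      by (intro mult_right_mono K) simp
    finally have "norm (cadjoint T y) * norm (cadjoint T y) \<le> norm (cadjoint T y) * (norm y * K)"
      by (simp add: mult_ac)
    then show ?thesis using False by simp
  qed
  then have "bounded_linear (cadjoint T)"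
    by (intro bounded_linear_intro [where K = K] add)
      (simp_all add: scale flip: scaleC_of_real)
  then show ?thesis by (simp add: bounded_clinear_def scale)
qed

lemma inverse_op:
  assumes "invertible_op T"
  shows "bounded_clinear (inv T)" "T (inv T x) = x" "inv T (T x) = x"
proof -
  obtain S where S: "bounded_clinear S" "S \<circ> T = id" "T \<circ> S = id"
    using assms by (auto simp: invertible_op_def)
  then have inv: "inv T = S" by (intro inv_unique_comp)
  show "bounded_clinear (inv T)" "T (inv T x) = x" "inv T (T x) = x"
    using S by (auto simp: inv fun_eq_iff)
qed

lemma invertible_op_bounded_clinear: "invertible_op T \<Longrightarrow> bounded_clinear T"
  by (simp add: invertible_op_def)

lemma bounded_below_inj:
  assumes T: "bounded_clinear T" and c: "c > 0" "\<And>x. c * norm x \<le> norm (T x)"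
  shows "inj T"
proof (rule injI)
  fix x y assume "T x = T y"
  then have "c * norm (x - y) \<le> 0"
    using c(2) [of "x - y"] by (simp add: bounded_clinear_diff [OF T])
  then show "x = y" using c(1) by (simp add: mult_le_0_iff)
qed

lemma invertible_opI:
  assumes T: "bounded_clinear T" and surj: "surj T"
    and c: "c > 0" "\<And>x. c * norm x \<le> norm (T x)"
  shows "invertible_op T"
proof -
  have "inj T" by (rule bounded_below_inj [OF T c])
  have r: "T (inv T x) = x" for x by (rule surj_f_inv_f [OF surj])
  have l: "inv T (T x) = x" for x by (rule inv_f_f [OF \<open>inj T\<close>])
  have add: "inv T (x + y) = inv T x + inv T y" for x y
    by (rule injD [OF \<open>inj T\<close>]) (simp add: r bounded_clinear_add [OF T])
  have scale: "inv T (a *\<^sub>C x) = a *\<^sub>C inv T x" for a x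
    by (rule injD [OF \<open>inj T\<close>]) (simp add: r bounded_clinear_scaleC [OF T])
  have "norm (inv T x) \<le> norm x * (1 / c)" for x
    using c(2) [of "inv T x"] c(1) by (simp add: r field_simps)
  then have "bounded_linear (inv T)"
    by (intro bounded_linear_intro [where K = "1 / c"] add)
      (simp_all add: scale flip: scaleC_of_real)
  then have "bounded_clinear (inv T)"
    by (simp add: bounded_clinear_def scale)
  then show ?thesis
    using T l r by (auto simp: invertible_op_def fun_eq_iff intro!: exI [of _ "inv T"])
qed


section \<open>Coercive operators and their square roots\<close>

text \<open>
  A suitable multiple of a coercive operator is at distance less than one from the identity; this
  makes inversion and the extraction of square roots contraction problems.
\<close>

lemma coercive_near_identity:
  fixes S :: "'a::real_inner \<Rightarrow> 'a"
  assumes S: "bounded_linear S" and m: "m > 0" "\<And>x. m * (norm x)\<^sup>2 \<le> inner (S x) x"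
  shows "\<exists>t r. t > 0 \<and> 0 \<le> r \<and> r < 1 \<and> (\<forall>x. norm (x - t *\<^sub>R S x) \<le> r * norm x)"
proof -
  obtain K where K: "K > 0" "\<And>x. norm (S x) \<le> norm x * K"
    using bounded_linear.pos_bounded [OF S] by blast
  define c where "c = max K m"
  have c: "c > 0" "m \<le> c" using K(1) by (auto simp: c_def)
  have Sc: "norm (S x) \<le> c * norm x" for x
  proof -
    have "norm x * K \<le> norm x * c" by (intro mult_left_mono) (auto simp: c_def)
    with K(2) [of x] show ?thesis by (simp add: mult.commute)
  qed
  \<comment> \<open>The value of \<open>t\<close> minimises \<open>1 - 2 t m + t\<^sup>2 c\<^sup>2\<close>, which bounds the squared norm of \<open>I - t S\<close>.\<close>
  define t where "t = m / c\<^sup>2"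
  define r where "r = sqrt (1 - m\<^sup>2 / c\<^sup>2)"
  have q: "0 \<le> 1 - m\<^sup>2 / c\<^sup>2" "1 - m\<^sup>2 / c\<^sup>2 < 1"
    using c m(1) by (simp_all add: power_mono)
  have t: "t > 0" using c m(1) by (simp add: t_def)
  have "norm (x - t *\<^sub>R S x) \<le> r * norm x" for x
  proof (rule power2_le_imp_le)
    have "(norm (x - t *\<^sub>R S x))\<^sup>2 = (norm x)\<^sup>2 - 2 * t * inner (S x) x + t\<^sup>2 * (norm (S x))\<^sup>2"
      unfolding power2_norm_eq_inner
      by (simp add: inner_diff_left inner_diff_right inner_commute power2_eq_square algebra_simps)
    also have "\<dots> \<le> (norm x)\<^sup>2 - 2 * t * (m * (norm x)\<^sup>2) + t\<^sup>2 * (c * norm x)\<^sup>2"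
      using t m(2) Sc by (intro add_mono diff_mono mult_left_mono power_mono) auto
    also have "\<dots> = (1 - m\<^sup>2 / c\<^sup>2) * (norm x)\<^sup>2"
      using c by (simp add: t_def field_simps power2_eq_square)
    also have "\<dots> = (r * norm x)\<^sup>2"
      using q by (simp add: r_def power_mult_distrib)
    finally show "(norm (x - t *\<^sub>R S x))\<^sup>2 \<le> (r * norm x)\<^sup>2" .
    show "0 \<le> r * norm x" using q by (simp add: r_def)
  qed
  moreover have "0 \<le> r" "r < 1" using q by (auto simp: r_def)
  ultimately show ?thesis using t by blast
qed

lemma coercive_norm_ge:
  fixes S :: "'a::real_inner \<Rightarrow> 'a"
  assumes "m * (norm x)\<^sup>2 \<le> inner (S x) x"
  shows "m * norm x \<le> norm (S x)"
proof (cases "x = 0")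
  case False
  have "(m * norm x) * norm x \<le> norm (S x) * norm x"
    using assms norm_cauchy_schwarz [of "S x" x] by (simp add: power2_eq_square mult.assoc)
  then show ?thesis using False by simp
qed simp

lemma coercive_invertible:
  fixes S :: "'a::complex_hilbert \<Rightarrow> 'a"
  assumes S: "bounded_clinear S" and m: "m > 0" "\<And>x. m * (norm x)\<^sup>2 \<le> inner (S x) x"
  shows "invertible_op S"
proof (rule invertible_opI [OF S _ m(1)])
  show "m * norm x \<le> norm (S x)" for x
    by (rule coercive_norm_ge [OF m(2)])
  obtain t r where t: "t > 0" "0 \<le> r" "r < 1" "\<And>x. norm (x - t *\<^sub>R S x) \<le> r * norm x"
    using coercive_near_identity [OF bounded_clinear_bounded_linear [OF S] m] by blast
  have "\<exists>x. S x = y" for y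
  proof -
    have "dist (x - t *\<^sub>R (S x - y)) (x' - t *\<^sub>R (S x' - y)) \<le> r * dist x x'" for x x'
      using t(4) [of "x - x'"] by (simp add: dist_norm bounded_clinear_diff [OF S] algebra_simps)
    then obtain x where "x - t *\<^sub>R (S x - y) = x"
      using banach_fix_type [OF t(2,3), of "\<lambda>x. x - t *\<^sub>R (S x - y)"] by blast
    then show ?thesis using t(1) by auto
  qed
  then show "surj S" by (metis surjI)
qed

text \<open>
  For \<open>\<parallel>I - t S\<parallel> \<le> r < 1\<close> the square root of \<open>t S\<close> is \<open>I - Y\<close>, where \<open>Y\<close> solves
  \<open>Y = ((I - t S) + Y\<^sup>2) / 2\<close>.  The right-hand side is a contraction of the ball of radius \<open>r\<close>
  and preserves the closed set of symmetric complex-linear operators.  The operator \<open>T\<close> is then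
  \<open>t\<^sup>1\<^sup>/\<^sup>2 (I - Y)\<^sup>-\<^sup>1\<close>.
\<close>

lemma coercive_normalizer:
  fixes S :: "'a::complex_hilbert \<Rightarrow> 'a"
  assumes S: "bounded_clinear S" and m: "m > 0" "\<And>x. m * (norm x)\<^sup>2 \<le> inner (S x) x"
    and sym: "\<And>x y. cinner (S x) y = cinner x (S y)"
  shows "\<exists>T. invertible_op T \<and> (\<forall>x y. cinner (S (T x)) (T y) = cinner x y)"
proof -
  obtain t r where t: "t > 0" "0 \<le> r" "r < 1" "\<And>x. norm (x - t *\<^sub>R S x) \<le> r * norm x"
    using coercive_near_identity [OF bounded_clinear_bounded_linear [OF S] m] by blast
  define K where "K = Blinfun (\<lambda>x. x - t *\<^sub>R S x)"
  have "bounded_linear (\<lambda>x. x - t *\<^sub>R S x)"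
    by (intro bounded_linear_intros bounded_clinear_bounded_linear [OF S])
  then have K: "blinfun_apply K x = x - t *\<^sub>R S x" for x
    by (simp add: K_def bounded_linear_Blinfun_apply)
  have norm_K: "norm K \<le> r"
    by (rule norm_blinfun_bound) (use t K in auto)
  define D where "D = {Y :: 'a \<Rightarrow>\<^sub>L 'a. norm Y \<le> r \<and>
    (\<forall>x y. inner (blinfun_apply Y x) y = inner x (blinfun_apply Y y)) \<and>
    (\<forall>a x. blinfun_apply Y (a *\<^sub>C x) = a *\<^sub>C blinfun_apply Y x)}"
  define F where "F Y = (1/2) *\<^sub>R (K + (Y o\<^sub>L Y))" for Y :: "'a \<Rightarrow>\<^sub>L 'a"
  have cont: "continuous_on UNIV (\<lambda>Y :: 'a \<Rightarrow>\<^sub>L 'a. blinfun_apply Y x)" for x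
    by (rule linear_continuous_on [OF blinfun.bounded_linear_left])
  have scaleC_cont: "continuous_on UNIV (\<lambda>Y :: 'a \<Rightarrow>\<^sub>L 'a. a *\<^sub>C blinfun_apply Y x)" for a x
  proof -
    have "bounded_linear (\<lambda>x :: 'a. a *\<^sub>C x)"
      by (rule bounded_linear_intro [where K = "cmod a"])
        (simp_all add: scaleC_add_right scaleC_scaleR norm_scaleC mult.commute)
    from bounded_linear.continuous_on [OF this cont] show ?thesis .
  qed
  have "closed D"
    unfolding D_def
    by (intro closed_Collect_conj closed_Collect_all closed_Collect_le closed_Collect_eq
        continuous_on_inner continuous_on_norm continuous_on_id continuous_on_const
        cont scaleC_cont)
  then have "complete D" by (simp add: complete_eq_closed)
  moreover have "D \<noteq> {}"
  proof -
    have "(0 :: 'a \<Rightarrow>\<^sub>L 'a) \<in> D" using t by (simp add: D_def)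
    then show ?thesis by blast
  qed
  moreover have "F ` D \<subseteq> D"
  proof (rule image_subsetI)
    fix Y assume Y: "Y \<in> D"
    have "norm (F Y) \<le> (r + r * r) / 2"
    proof -
      have "norm (Y o\<^sub>L Y) \<le> norm Y * norm Y" by (rule norm_blinfun_compose)
      also have "\<dots> \<le> r * r" using Y t by (intro mult_mono) (auto simp: D_def)
      finally have "norm (K + (Y o\<^sub>L Y)) \<le> r + r * r"
        using norm_K norm_triangle_ineq [of K "Y o\<^sub>L Y"] by linarith
      then show ?thesis by (simp add: F_def)
    qed
    also have "\<dots> \<le> r"
      using mult_left_mono [of r 1 r] t by simp
    finally have "norm (F Y) \<le> r" .
    moreover have "inner (blinfun_apply (F Y) x) y = inner x (blinfun_apply (F Y) y)" for x y
    proof -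
      have "inner (S x) y = inner x (S y)" using sym [of x y] by (metis Re_cinner)
      moreover have "inner (blinfun_apply Y (blinfun_apply Y x)) y =
          inner x (blinfun_apply Y (blinfun_apply Y y))"
        using Y by (simp add: D_def)
      ultimately show ?thesis
        by (simp add: F_def K blinfun.add_left blinfun.scaleR_left inner_add_left inner_add_right
            inner_diff_left inner_diff_right)
    qed
    moreover have "blinfun_apply (F Y) (a *\<^sub>C x) = a *\<^sub>C blinfun_apply (F Y) x" for a x
      using Y by (simp add: F_def D_def K blinfun.add_left blinfun.scaleR_left scaleC_add_right
          scaleC_scaleR scaleC_diff_right bounded_clinear_scaleC [OF S])
    ultimately show "F Y \<in> D" by (simp add: D_def)
  qed
  moreover have "dist (F Y) (F Z) \<le> r * dist Y Z" if "Y \<in> D" "Z \<in> D" for Y Z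
  proof -
    have "F Y - F Z = (1/2) *\<^sub>R ((Y o\<^sub>L (Y - Z)) + ((Y - Z) o\<^sub>L Z))"
      by (rule blinfun_eqI) (simp add: F_def blinfun.add_left blinfun.scaleR_left
          blinfun.diff_left blinfun.diff_right algebra_simps)
    moreover have "norm (Y o\<^sub>L (Y - Z)) \<le> r * norm (Y - Z)"
      using that by (intro order_trans [OF norm_blinfun_compose] mult_right_mono) (auto simp: D_def)
    moreover have "norm ((Y - Z) o\<^sub>L Z) \<le> norm (Y - Z) * r"
      using that by (intro order_trans [OF norm_blinfun_compose] mult_left_mono) (auto simp: D_def)
    ultimately show ?thesis
      using norm_triangle_ineq [of "Y o\<^sub>L (Y - Z)" "(Y - Z) o\<^sub>L Z"]
      by (simp add: dist_norm mult.commute)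
  qed
  ultimately obtain Y where Y: "Y \<in> D" "F Y = Y"
    using Banach_fix [of D r F] t by blast
  define R where "R x = x - blinfun_apply Y x" for x
  have R2: "R (R x) = t *\<^sub>R S x" for x
  proof -
    have "blinfun_apply (F Y) x = blinfun_apply Y x" by (simp add: Y(2))
    then have "(1/2) *\<^sub>R (x - t *\<^sub>R S x + blinfun_apply Y (blinfun_apply Y x)) = blinfun_apply Y x"
      by (simp add: F_def K blinfun.add_left blinfun.scaleR_left)
    then have "2 *\<^sub>R ((1/2) *\<^sub>R (x - t *\<^sub>R S x + blinfun_apply Y (blinfun_apply Y x))) =
        2 *\<^sub>R blinfun_apply Y x" by (simp only:)
    then have "x - t *\<^sub>R S x + blinfun_apply Y (blinfun_apply Y x) =
        blinfun_apply Y x + blinfun_apply Y x" by (simp add: scaleR_2)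
    then show ?thesis
      by (simp add: R_def blinfun.diff_right algebra_simps)
  qed
  have R_lin: "bounded_linear R"
    unfolding R_def by (intro bounded_linear_intros)
  have R: "bounded_clinear R"
    using Y(1) R_lin by (simp add: bounded_clinear_def R_def D_def scaleC_diff_right)
  have R_sym: "inner (R x) y = inner x (R y)" for x y
    using Y(1) by (simp add: R_def D_def inner_diff_left inner_diff_right)
  have R_pos: "(1 - r) * (norm x)\<^sup>2 \<le> inner (R x) x" for x
  proof -
    have "inner (blinfun_apply Y x) x \<le> norm (blinfun_apply Y x) * norm x"
      by (rule norm_cauchy_schwarz)
    also have "\<dots> \<le> (norm Y * norm x) * norm x"
      by (intro mult_right_mono norm_blinfun) simp
    also have "\<dots> \<le> (r * norm x) * norm x"
      using Y(1) by (intro mult_right_mono) (auto simp: D_def)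
    finally show ?thesis
      by (simp add: R_def inner_diff_left power2_norm_eq_inner [symmetric] power2_eq_square
          algebra_simps)
  qed
  have R_inv: "invertible_op R"
    by (rule coercive_invertible [OF R _ R_pos]) (use t in simp)
  have c: "bounded_clinear (inv R)" by (rule inverse_op(1) [OF R_inv])
  define T where "T x = sqrt t *\<^sub>R inv R x" for x
  have T_lin: "bounded_clinear T"
  proof -
    have "bounded_linear T"
      unfolding T_def by (intro bounded_linear_intros bounded_clinear_bounded_linear c)
    then show ?thesis
      by (simp add: bounded_clinear_def T_def bounded_clinear_scaleC [OF c] scaleC_scaleR)
  qed
  have "invertible_op T"
  proof -
    define U where "U x = (1 / sqrt t) *\<^sub>R R x" for x
    have "bounded_linear U"
      unfolding U_def by (intro bounded_linear_intros R_lin)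
    then have "bounded_clinear U"
      by (simp add: bounded_clinear_def U_def bounded_clinear_scaleC [OF R] scaleC_scaleR)
    moreover have "U \<circ> T = id" "T \<circ> U = id"
      using t(1) by (auto simp: fun_eq_iff U_def T_def inverse_op [OF R_inv]
          linear_simps [OF R_lin] linear_simps [OF bounded_clinear_bounded_linear [OF c]])
    ultimately show ?thesis using T_lin by (auto simp: invertible_op_def)
  qed
  moreover have "cinner (S (T x)) (T y) = cinner x y" for x y
  proof -
    have ST: "S (T x) = (1 / sqrt t) *\<^sub>R R x" for x
    proof -
      have "t *\<^sub>R S (T x) = sqrt t *\<^sub>R R x"
        by (simp add: R2 [symmetric] T_def linear_simps [OF R_lin] inverse_op [OF R_inv])
      then have "(1 / t) *\<^sub>R (t *\<^sub>R S (T x)) = (1 / t) *\<^sub>R (sqrt t *\<^sub>R R x)" by (simp only:)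
      then show ?thesis using t(1) by (simp add: real_div_sqrt real_sqrt_divide field_simps)
    qed
    have "inner (S (T x)) (T y) = inner x y" for x
      unfolding ST using t(1) by (simp add: T_def R_sym inverse_op [OF R_inv])
    then show ?thesis
      by (rule cinner_of_inner [OF bounded_clinear_compose [OF S T_lin]])
  qed
  ultimately show ?thesis by blast
qed


section \<open>Injective operators with closed range\<close>

text \<open>
  The Baire category theorem in the range makes every vector of the range approximable, up to half
  its norm, by images of vectors of comparable norm; summing the successive corrections gives a
  preimage of controlled norm, and by injectivity this is the only preimage.
\<close>

lemma injective_closed_range_bounded_below:
  fixes f :: "'a::banach \<Rightarrow> 'b::banach"
  assumes f: "bounded_linear f" and inj: "inj f" and closed: "closed (range f)"
  shows "\<exists>c>0. \<forall>x. c * norm x \<le> norm (f x)"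
proof -
  interpret f: bounded_linear f by (rule f)
  let ?X = "top_of_set (range f)"
  define F where "F n = closure (f ` cball 0 (real n))" for n :: nat
  have F_sub: "F n \<subseteq> range f" for n
    unfolding F_def by (rule closure_minimal [OF _ closed]) auto
  have F_cover: "\<Union>(range F) = range f"
  proof
    show "range f \<subseteq> \<Union>(range F)"
    proof (rule image_subsetI)
      fix x :: 'a
      obtain n where "norm x \<le> real n" using real_arch_simple by blast
      then have "f x \<in> F n"
        unfolding F_def by (intro subsetD [OF closure_subset]) auto
      then show "f x \<in> \<Union>(range F)" by blast
    qed
  qed (use F_sub in blast)
  have "\<exists>n. ?X interior_of F n \<noteq> {}"
  proof (rule ccontr)
    assume *: "\<nexists>n. ?X interior_of F n \<noteq> {}"
    have "completely_metrizable_space ?X"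
      by (rule completely_metrizable_space_closedin [OF completely_metrizable_space_euclidean])
        (use closed in \<open>simp flip: closed_closedin\<close>)
    moreover have "closedin ?X (F n)" for n
      by (rule closed_subset [OF F_sub]) (simp add: F_def)
    ultimately have "?X interior_of \<Union>(range F) = {}"
      using * by (intro Baire_category_alt) blast+
    moreover have "?X interior_of (range f) = range f"
      using interior_of_topspace [of ?X] by simp
    ultimately show False by (simp add: F_cover)
  qed
  then obtain n y U where U: "openin ?X U" "y \<in> U" "U \<subseteq> F n"
    by (auto simp: interior_of_def)
  then obtain e where e: "e > 0" "ball y e \<inter> range f \<subseteq> F n"
    by (meson openin_contains_ball subset_trans)
  have y: "y \<in> F n" using U by blast
  have small: "\<exists>x. norm x \<le> 2 * real n \<and> norm (w - f x) < e / 4"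
    if w: "w \<in> range f" "norm w < e" for w
  proof -
    have "y + w \<in> range f"
      using w(1) y F_sub [of n] by (auto simp flip: f.add)
    moreover have "y + w \<in> ball y e" using w(2) by (simp add: dist_norm)
    ultimately have "y + w \<in> F n" using e(2) by blast
    moreover have "\<exists>a. norm a \<le> real n \<and> dist (f a) v < e / 8" if "v \<in> F n" for v
    proof -
      have "\<exists>u\<in>f ` cball 0 (real n). dist u v < e / 8"
        using that e(1) unfolding F_def closure_approachable by (meson divide_pos_pos zero_less_numeral)
      then show ?thesis by auto
    qed
    ultimately obtain a b where a: "norm a \<le> real n" "dist (f a) (y + w) < e / 8"
      and b: "norm b \<le> real n" "dist (f b) y < e / 8"
      using y by meson
    have eq: "w - f (a - b) = (f b - y) - (f a - (y + w))" by (simp add: f.diff)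
    have "norm (w - f (a - b)) < e / 4"
      using a(2) b(2) norm_triangle_ineq4 [of "f b - y" "f a - (y + w)"]
      unfolding eq dist_norm by linarith
    moreover have "norm (a - b) \<le> 2 * real n"
      using a(1) b(1) norm_triangle_ineq4 [of a b] by linarith
    ultimately show ?thesis by blast
  qed
  define K where "K = 4 * real n / e"
  have K: "K \<ge> 0" using e(1) by (simp add: K_def)
  have approx: "\<exists>x. norm x \<le> K * norm z \<and> norm (z - f x) \<le> norm z / 2" if z: "z \<in> range f" for z
  proof (cases "z = 0")
    case True
    then show ?thesis by (intro exI [of _ 0]) (simp add: f.zero)
  next
    case False
    define s where "s = 2 * norm z / e"
    have s: "s > 0" using False e(1) by (simp add: s_def)
    have "(1 / s) *\<^sub>R z \<in> range f"
      using z by (auto simp flip: f.scaleR)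
    moreover have "norm ((1 / s) *\<^sub>R z) < e"
      using False e(1) by (simp add: s_def)
    ultimately obtain x where x: "norm x \<le> 2 * real n" "norm ((1 / s) *\<^sub>R z - f x) < e / 4"
      using small by blast
    have "norm (s *\<^sub>R x) \<le> s * (2 * real n)" using x(1) s by simp
    also have "\<dots> = K * norm z" using e(1) by (simp add: s_def K_def)
    finally have "norm (s *\<^sub>R x) \<le> K * norm z" .
    moreover have "norm (z - f (s *\<^sub>R x)) \<le> norm z / 2"
    proof -
      have "z - f (s *\<^sub>R x) = s *\<^sub>R ((1 / s) *\<^sub>R z - f x)"
        using s by (simp add: f.scaleR scaleR_diff_right)
      then have "norm (z - f (s *\<^sub>R x)) = s * norm ((1 / s) *\<^sub>R z - f x)"
        using s by simp
      also have "\<dots> \<le> s * (e / 4)" using x(2) s by (intro mult_left_mono) auto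
      also have "\<dots> = norm z / 2" using e(1) by (simp add: s_def)
      finally show ?thesis .
    qed
    ultimately show ?thesis by blast
  qed
  then obtain g where g: "\<And>z. z \<in> range f \<Longrightarrow> norm (g z) \<le> K * norm z"
    "\<And>z. z \<in> range f \<Longrightarrow> norm (z - f (g z)) \<le> norm z / 2"
    by metis
  have bound: "norm x \<le> 2 * K * norm (f x)" for x
  proof -
    \<comment> \<open>The remainders after \<open>k\<close> corrections.\<close>
    define r where "r k = ((\<lambda>z. z - f (g z)) ^^ k) (f x)" for k
    have r_Suc: "r (Suc k) = r k - f (g (r k))" for k by (simp add: r_def)
    have r_range: "r k \<in> range f" for k
    proof (induction k)
      case 0 show ?case by (simp add: r_def)
    next
      case (Suc k)
      then show ?case by (auto simp: r_Suc simp flip: f.diff)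
    qed
    have r_norm: "norm (r k) \<le> norm (f x) * (1/2) ^ k" for k
    proof (induction k)
      case 0 show ?case by (simp add: r_def)
    next
      case (Suc k)
      then show ?case using g(2) [OF r_range, of k] by (simp add: r_Suc)
    qed
    have g_norm: "norm (g (r k)) \<le> K * norm (f x) * (1/2) ^ k" for k
      using g(1) [OF r_range, of k] mult_left_mono [OF r_norm K, of k] by (simp add: mult.assoc)
    have geo: "(\<lambda>k. K * norm (f x) * (1/2) ^ k) sums (K * norm (f x) * 2)"
      using sums_mult [OF geometric_sums [of "1/2 :: real"], of "K * norm (f x)"] by simp
    have summable: "summable (\<lambda>k. g (r k))"
      by (rule summable_comparison_test' [OF sums_summable [OF geo]]) (rule g_norm)
    have partial: "f (\<Sum>i<k. g (r i)) = f x - r k" for k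
    proof (induction k)
      case 0 show ?case by (simp add: r_def f.zero)
    next
      case (Suc k)
      then show ?case by (simp add: f.add r_Suc)
    qed
    have "(\<lambda>k. norm (f x) * (1/2) ^ k) \<longlonglongrightarrow> norm (f x) * 0"
      by (intro tendsto_intros LIMSEQ_realpow_zero) auto
    then have "r \<longlonglongrightarrow> 0"
      by (intro Lim_null_comparison [of r "\<lambda>k. norm (f x) * (1/2) ^ k"]) (simp_all add: r_norm)
    then have "(\<lambda>k. f x - r k) \<longlonglongrightarrow> f x - 0" by (intro tendsto_intros)
    moreover have "(\<lambda>k. f (\<Sum>i<k. g (r i))) \<longlonglongrightarrow> f (\<Sum>k. g (r k))"
      by (rule f.tendsto [OF summable_LIMSEQ [OF summable]])
    ultimately have "f (\<Sum>k. g (r k)) = f x"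
      unfolding partial by (simp add: LIMSEQ_unique)
    then have "x = (\<Sum>k. g (r k))" using inj by (simp add: inj_eq)
    moreover have "norm (\<Sum>k. g (r k)) \<le> K * norm (f x) * 2"
      using norm_suminf_le [OF g_norm sums_summable [OF geo]] by (simp add: sums_unique [OF geo])
    ultimately show ?thesis by (simp add: mult_ac)
  qed
  have "norm x \<le> (2 * K + 1) * norm (f x)" for x
    unfolding distrib_right using bound [of x] norm_ge_zero [of "f x"] by linarith
  then have "1 / (2 * K + 1) * norm x \<le> norm (f x)" for x
    using K by (simp add: divide_le_eq mult.commute)
  moreover have "1 / (2 * K + 1) > 0" using K by simp
  ultimately show ?thesis by blast
qed

section \<open>Analysis operators\<close>

lemma bounded_clinear_coord: "bounded_clinear (\<lambda>f :: ('j, 'o::complex_hilbert) ell2. coord f j)"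
  unfolding bounded_clinear_def
proof (intro conjI allI)
  show "bounded_linear (\<lambda>f :: ('j, 'o) ell2. coord f j)"
    by (rule bounded_linear_intro [where K = 1])
      (simp_all add: plus_ell2.rep_eq scaleR_ell2.rep_eq norm_coord_le)
qed (simp add: scaleC_ell2.rep_eq)

lemma cinner_L_op: "cinner f (L_op j h) = cinner (coord f j) h"
  for f :: "('j, 'o::complex_hilbert) ell2"
proof -
  have one: "1 *\<^sub>C h = h" and zero: "0 *\<^sub>C h = 0"
    using scaleC_of_real [of 1 h] scaleC_of_real [of 0 h] by simp_all
  have "coord (L_op j h) i = (if i = j then h else 0)" for i
    by (simp add: L_op_def tensor.rep_eq ell2_basis.rep_eq one zero)
  then have "cinner f (L_op j h) = (\<Sum>\<^sub>\<infinity>i. if i = j then cinner (coord f j) h else 0)"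
    unfolding cinner_ell2.rep_eq by (intro infsum_cong) simp
  also have "\<dots> = cinner (coord f j) h"
    by (rule infsumI, rule has_sum_finite_neutralI [of "{j}"]) auto
  finally show ?thesis .
qed

text \<open>
  A bounded operator \<open>\<theta>\<close> into the space of square-summable families analyses the family \<open>C\<close> if
  its components are the operators \<open>C j\<close>.  For families with such a \<open>\<theta>\<close>, all frame notions
  translate into properties of the single operator \<open>\<theta>\<close>.
\<close>

definition analyses ::
    "('j \<Rightarrow> 'a::complex_hilbert \<Rightarrow> 'o::complex_hilbert) \<Rightarrow> ('a \<Rightarrow> ('j, 'o) ell2) \<Rightarrow> bool"
  where "analyses C \<theta> \<longleftrightarrow> bounded_clinear \<theta> \<and> (\<forall>x j. coord (\<theta> x) j = C j x)"

lemma analyses_clinear: "analyses C \<theta> \<Longrightarrow> bounded_clinear \<theta>"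
  by (simp add: analyses_def)

lemma analyses_component:
  assumes "analyses C \<theta>"
  shows "bounded_clinear (C j)"
proof -
  have "bounded_clinear (\<lambda>x. coord (\<theta> x) j)"
    by (rule bounded_clinear_compose [OF bounded_clinear_coord analyses_clinear [OF assms]])
  with assms show ?thesis by (simp add: analyses_def)
qed

lemma analyses_operator:
  assumes "analyses C \<theta>"
  shows "analysis_operator C = \<theta>"
proof
  show "analysis_operator C x = \<theta> x" for x
    using infsumI [OF has_sum_basis_tensor [of "\<theta> x"]] assms
    by (simp add: analysis_operator_def L_op_def analyses_def)
qed

lemma analyses_has_sum:
  assumes "analyses C \<theta>"
  shows "((\<lambda>j. cadjoint (C j) (C j x)) has_sum cadjoint \<theta> (\<theta> x)) UNIV"
proof -
  note \<theta> = analyses_clinear [OF assms]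
  have "cadjoint \<theta> (L_op j h) = cadjoint (C j) h" for j h
    by (rule cinner_eqI)
      (use assms in \<open>simp add: cinner_L_op analyses_def analyses_component [OF assms]
        flip: cinner_cadjoint\<close>)
  moreover have "((\<lambda>j. L_op j (C j x)) has_sum \<theta> x) UNIV"
    using has_sum_basis_tensor [of "\<theta> x"] assms by (simp add: L_op_def analyses_def)
  then have "((\<lambda>j. cadjoint \<theta> (L_op j (C j x))) has_sum cadjoint \<theta> (\<theta> x)) UNIV"
    by (rule has_sum_bounded_linear [OF bounded_clinear_bounded_linear
          [OF bounded_clinear_cadjoint [OF \<theta>]], unfolded o_def])
  ultimately show ?thesis by simp
qed

lemma analyses_frame_operator:
  assumes "analyses C \<theta>"
  shows "frame_operator C x = cadjoint \<theta> (\<theta> x)"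
  unfolding frame_operator_def by (rule infsumI [OF analyses_has_sum [OF assms]])

lemma cinner_frame_operator:
  assumes "analyses C \<theta>"
  shows "cinner (frame_operator C x) y = cinner (\<theta> x) (\<theta> y)"
  by (simp add: analyses_frame_operator [OF assms]
      cinner_cadjoint_left [OF analyses_clinear [OF assms]])

lemma frame_operator_symmetric:
  assumes "analyses C \<theta>"
  shows "cinner (frame_operator C x) y = cinner x (frame_operator C y)"
  by (metis cinner_commute cinner_frame_operator [OF assms])

lemma bounded_clinear_frame_operator:
  assumes "analyses C \<theta>"
  shows "bounded_clinear (frame_operator C)"
proof -
  have "bounded_clinear (\<lambda>x. cadjoint \<theta> (\<theta> x))"
    by (rule bounded_clinear_compose [OF bounded_clinear_cadjoint [OF analyses_clinear [OF assms]]
          analyses_clinear [OF assms]])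
  then show ?thesis by (simp flip: analyses_frame_operator [OF assms])
qed

lemma bounded_below_coercive:
  assumes C: "analyses C \<theta>" and c: "c > 0" "c * norm x \<le> norm (\<theta> x)"
  shows "c\<^sup>2 * (norm x)\<^sup>2 \<le> inner (frame_operator C x) x"
proof -
  have "(c * norm x)\<^sup>2 \<le> (norm (\<theta> x))\<^sup>2" using c by (intro power_mono) auto
  also have "\<dots> = Re (cinner (\<theta> x) (\<theta> x))" by (simp add: cinner_self)
  also have "\<dots> = inner (frame_operator C x) x"
    by (simp flip: Re_cinner cinner_frame_operator [OF C])
  finally show ?thesis by (simp add: power_mult_distrib)
qed

lemma ov_frame_iff_bounded_below:
  assumes C: "analyses C \<theta>"
  shows "ov_frame C \<longleftrightarrow> (\<exists>c>0. \<forall>x. c * norm x \<le> norm (\<theta> x))"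
proof
  assume "ov_frame C"
  then have inv: "invertible_op (frame_operator C)" by (simp add: ov_frame_def)
  let ?R = "\<lambda>y. inv (frame_operator C) (cadjoint \<theta> y)"
  have "bounded_clinear ?R"
    by (rule bounded_clinear_compose [OF inverse_op(1) [OF inv]
          bounded_clinear_cadjoint [OF analyses_clinear [OF C]]])
  from bounded_linear.pos_bounded [OF bounded_clinear_bounded_linear [OF this]]
  obtain K where K: "K > 0" "\<And>y. norm (?R y) \<le> norm y * K" by blast
  have "norm x \<le> norm (\<theta> x) * K" for x
    using K(2) [of "\<theta> x"] by (simp add: inverse_op [OF inv] flip: analyses_frame_operator [OF C])
  then have "1 / K * norm x \<le> norm (\<theta> x)" for x
    using K(1) by (simp add: divide_le_eq)
  moreover have "1 / K > 0" using K(1) by simp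
  ultimately show "\<exists>c>0. \<forall>x. c * norm x \<le> norm (\<theta> x)" by blast
next
  assume "\<exists>c>0. \<forall>x. c * norm x \<le> norm (\<theta> x)"
  then obtain c where c: "c > 0" "\<And>x. c * norm x \<le> norm (\<theta> x)" by blast
  have "invertible_op (frame_operator C)"
    by (rule coercive_invertible [OF bounded_clinear_frame_operator [OF C] _
          bounded_below_coercive [OF C c]]) (use c in simp)
  moreover have "positive_op (frame_operator C)"
    by (simp add: positive_op_def cinner_frame_operator [OF C] cinner_self)
  moreover have "(\<lambda>j. cadjoint (C j) (C j x)) summable_on UNIV" for x
    using analyses_has_sum [OF C] by (rule has_sum_imp_summable)
  ultimately show "ov_frame C"
    using analyses_component [OF C] bounded_clinear_frame_operator [OF C]
    by (simp add: ov_frame_def)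
qed

lemma isometric_norm:
  fixes \<theta> :: "'a::complex_hilbert \<Rightarrow> 'b::complex_hilbert"
  assumes "\<And>x y. cinner (\<theta> x) (\<theta> y) = cinner x y"
  shows "norm (\<theta> x) = norm x"
proof -
  have "complex_of_real ((norm (\<theta> x))\<^sup>2) = complex_of_real ((norm x)\<^sup>2)"
    using assms [of x x] by (simp only: cinner_self)
  then have "(norm (\<theta> x))\<^sup>2 = (norm x)\<^sup>2" using of_real_eq_iff by blast
  then show ?thesis by simp
qed

lemma parseval_frame_iff_isometric:
  assumes C: "analyses C \<theta>"
  shows "parseval_frame C \<longleftrightarrow> (\<forall>x y. cinner (\<theta> x) (\<theta> y) = cinner x y)"
proof
  assume "parseval_frame C"
  then show "\<forall>x y. cinner (\<theta> x) (\<theta> y) = cinner x y"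
    by (simp add: parseval_frame_def flip: cinner_frame_operator [OF C])
next
  assume iso: "\<forall>x y. cinner (\<theta> x) (\<theta> y) = cinner x y"
  have "ov_frame C"
    unfolding ov_frame_iff_bounded_below [OF C]
    using iso by (intro exI [of _ 1]) (simp add: isometric_norm)
  moreover have "frame_operator C x = x" for x
    by (rule cinner_eqI)
      (simp add: iso cinner_frame_operator [OF C] flip: frame_operator_symmetric [OF C])
  ultimately show "parseval_frame C" by (simp add: parseval_frame_def fun_eq_iff)
qed

lemma orthonormal_frame_iff_unitary:
  assumes C: "analyses C \<theta>"
  shows "orthonormal_frame C \<longleftrightarrow> parseval_frame C \<and> surj \<theta>"
proof -
  have "\<theta> \<circ> cadjoint \<theta> = id \<longleftrightarrow> surj \<theta>" if "parseval_frame C"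
  proof
    assume "\<theta> \<circ> cadjoint \<theta> = id"
    then show "surj \<theta>" by (metis comp_apply id_apply surjI)
  next
    assume surj: "surj \<theta>"
    have "cadjoint \<theta> (\<theta> x) = x" for x
      using that by (simp add: parseval_frame_def flip: analyses_frame_operator [OF C])
    then have "\<theta> (cadjoint \<theta> v) = v" for v
      using surj by (metis surjD)
    then show "\<theta> \<circ> cadjoint \<theta> = id" by (simp add: fun_eq_iff)
  qed
  then show ?thesis
    by (auto simp: orthonormal_frame_def analyses_operator [OF C])
qed

lemma ov_frame_analyses:
  assumes "ov_frame C"
  shows "analyses C (analysis_operator C)"
proof -
  let ?S = "frame_operator C"
  have C: "bounded_clinear (C j)" for j using assms by (simp add: ov_frame_def)
  have S: "bounded_clinear ?S" using assms by (simp add: ov_frame_def)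
  have sum: "((\<lambda>j. (norm (C j x))\<^sup>2) has_sum inner (?S x) x) UNIV" for x
  proof -
    have "((\<lambda>j. cadjoint (C j) (C j x)) has_sum ?S x) UNIV"
      using assms by (simp add: ov_frame_def frame_operator_def)
    from has_sum_bounded_linear [OF bounded_linear_inner_left [of x] this]
    have "((\<lambda>j. inner (cadjoint (C j) (C j x)) x) has_sum inner (?S x) x) UNIV"
      by (simp add: o_def)
    moreover have "inner (cadjoint (C j) (C j x)) x = (norm (C j x))\<^sup>2" for j
      by (simp add: cinner_cadjoint_left [OF C] cinner_self flip: Re_cinner)
    ultimately show ?thesis by simp
  qed
  define \<theta> where "\<theta> x = Abs_ell2 (\<lambda>j. C j x)" for x
  have coord: "coord (\<theta> x) j = C j x" for x j
    using has_sum_imp_summable [OF sum [of x]]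
    by (simp add: \<theta>_def Abs_ell2_inverse square_summable_def)
  have add: "\<theta> (x + y) = \<theta> x + \<theta> y" for x y
    by (rule ell2_eqI) (simp add: coord plus_ell2.rep_eq bounded_clinear_add [OF C])
  have scale: "\<theta> (c *\<^sub>C x) = c *\<^sub>C \<theta> x" for c x
    by (rule ell2_eqI) (simp add: coord scaleC_ell2.rep_eq bounded_clinear_scaleC [OF C])
  obtain K where K: "K > 0" "\<And>x. norm (?S x) \<le> norm x * K"
    using bounded_linear.pos_bounded [OF bounded_clinear_bounded_linear [OF S]] by blast
  have "norm (\<theta> x) \<le> norm x * sqrt K" for x
  proof (rule power2_le_imp_le)
    have "(norm (\<theta> x))\<^sup>2 = inner (?S x) x"
      unfolding norm_ell2_square coord by (rule infsumI [OF sum])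
    also have "\<dots> \<le> norm (?S x) * norm x" by (rule norm_cauchy_schwarz)
    also have "\<dots> \<le> (norm x * K) * norm x" by (intro mult_right_mono K) simp
    also have "\<dots> = (norm x * sqrt K)\<^sup>2"
      using K(1) by (simp add: power_mult_distrib power2_eq_square)
    finally show "(norm (\<theta> x))\<^sup>2 \<le> (norm x * sqrt K)\<^sup>2" .
  qed (use K(1) in simp)
  then have "bounded_linear \<theta>"
    by (intro bounded_linear_intro [where K = "sqrt K"] add)
      (simp_all add: scale flip: scaleC_of_real)
  then have "analyses C \<theta>" by (simp add: analyses_def bounded_clinear_def scale coord)
  then show ?thesis using analyses_operator by metis
qed

lemma analyses_compose:
  assumes "analyses C \<theta>" "bounded_clinear T"
  shows "analyses (\<lambda>j. C j \<circ> T) (\<lambda>x. \<theta> (T x))"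
  using assms by (simp add: analyses_def bounded_clinear_compose)

lemma bounded_clinear_fst: "bounded_clinear fst"
  by (simp add: bounded_clinear_def bounded_linear_fst scaleC_prod_def)

lemma bounded_clinear_snd: "bounded_clinear snd"
  by (simp add: bounded_clinear_def bounded_linear_snd scaleC_prod_def)

lemma bounded_clinear_plus:
  "bounded_clinear S \<Longrightarrow> bounded_clinear T \<Longrightarrow> bounded_clinear (\<lambda>x. S x + T x)"
  by (simp add: bounded_clinear_def bounded_linear_add scaleC_add_right)

lemma analyses_dsum:
  assumes "analyses A \<alpha>" "analyses B \<beta>"
  shows "analyses (\<lambda>j. A j \<oplus>\<^sub>o B j) (\<lambda>z. \<alpha> (fst z) + \<beta> (snd z))"
  unfolding analyses_def
proof (intro conjI allI)
  show "bounded_clinear (\<lambda>z. \<alpha> (fst z) + \<beta> (snd z))"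
    by (rule bounded_clinear_plus
          [OF bounded_clinear_compose [OF analyses_clinear [OF assms(1)] bounded_clinear_fst]
            bounded_clinear_compose [OF analyses_clinear [OF assms(2)] bounded_clinear_snd]])
  show "coord (\<alpha> (fst z) + \<beta> (snd z)) j = (A j \<oplus>\<^sub>o B j) z" for z j
    using assms by (simp add: analyses_def plus_ell2.rep_eq op_dsum_def)
qed


section \<open>Frame projections\<close>

text \<open>The operator \<open>P\<close> with \<open>P = \<theta> S\<^sup>-\<^sup>1 \<theta>\<^sup>*\<close> is the identity on the range of \<open>\<theta>\<close>, has the same
  range, and has the same kernel as \<open>\<theta>\<^sup>*\<close>.\<close>

lemma frame_projection_analysis:
  assumes "ov_frame C"
  shows "frame_projection C (analysis_operator C x) = analysis_operator C x"
proof -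
  have "invertible_op (frame_operator C)" using assms by (simp add: ov_frame_def)
  then show ?thesis
    by (simp add: frame_projection_def inverse_op
        flip: analyses_frame_operator [OF ov_frame_analyses [OF assms]])
qed

lemma range_frame_projection:
  assumes "ov_frame C"
  shows "range (frame_projection C) = range (analysis_operator C)"
proof
  show "range (frame_projection C) \<subseteq> range (analysis_operator C)"
    by (auto simp: frame_projection_def)
  show "range (analysis_operator C) \<subseteq> range (frame_projection C)"
    by (rule image_subsetI) (metis frame_projection_analysis [OF assms] rangeI)
qed

lemma frame_projection_eq_zero_iff:
  assumes "ov_frame C"
  shows "frame_projection C v = 0 \<longleftrightarrow> cadjoint (analysis_operator C) v = 0"
proof -
  let ?\<theta> = "analysis_operator C"
  have \<theta>: "analyses C ?\<theta>" by (rule ov_frame_analyses [OF assms])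
  have inv: "invertible_op (frame_operator C)" using assms by (simp add: ov_frame_def)
  have "cadjoint ?\<theta> (frame_projection C v) = cadjoint ?\<theta> v"
    by (simp add: frame_projection_def inverse_op [OF inv] flip: analyses_frame_operator [OF \<theta>])
  moreover have "cadjoint ?\<theta> 0 = 0"
    by (rule bounded_clinear_zero [OF bounded_clinear_cadjoint [OF analyses_clinear [OF \<theta>]]])
  moreover have "?\<theta> (inv (frame_operator C) 0) = 0"
    by (simp add: bounded_clinear_zero [OF inverse_op(1) [OF inv]]
        bounded_clinear_zero [OF analyses_clinear [OF \<theta>]])
  ultimately show ?thesis by (auto simp: frame_projection_def)
qed


lemma frame_projection_kernel:
  assumes C: "ov_frame C"
  shows "frame_projection C v = 0 \<longleftrightarrow> (\<forall>x. cinner (analysis_operator C x) v = 0)"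
proof -
  have \<theta>: "bounded_clinear (analysis_operator C)"
    by (rule analyses_clinear [OF ov_frame_analyses [OF C]])
  show ?thesis
    unfolding frame_projection_eq_zero_iff [OF C] cinner_cadjoint [OF \<theta>]
    using cinner_eqI [of "cadjoint (analysis_operator C) v" 0] by auto
qed

lemma frame_projection_add:
  assumes C: "ov_frame C"
  shows "frame_projection C (u + v) = frame_projection C u + frame_projection C v"
proof -
  have \<theta>: "bounded_clinear (analysis_operator C)"
    by (rule analyses_clinear [OF ov_frame_analyses [OF C]])
  have inv: "invertible_op (frame_operator C)" using C by (simp add: ov_frame_def)
  show ?thesis
    by (simp add: frame_projection_def bounded_clinear_add [OF \<theta>]
        bounded_clinear_add [OF inverse_op(1) [OF inv]]
        bounded_clinear_add [OF bounded_clinear_cadjoint [OF \<theta>]])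
qed


section \<open>Pairs of frames\<close>

lemma cadjoint_comp_eq_zero_iff:
  assumes "bounded_clinear S"
  shows "cadjoint S \<circ> T = (\<lambda>_. 0) \<longleftrightarrow> (\<forall>x y. cinner (S x) (T y) = 0)"
proof
  assume "cadjoint S \<circ> T = (\<lambda>_. 0)"
  then have "cadjoint S (T y) = 0" for y by (metis comp_apply)
  then show "\<forall>x y. cinner (S x) (T y) = 0" by (simp add: cinner_cadjoint [OF assms])
next
  assume *: "\<forall>x y. cinner (S x) (T y) = 0"
  have "cadjoint S (T y) = 0" for y
    by (rule cinner_eqI) (simp add: * flip: cinner_cadjoint [OF assms])
  then show "cadjoint S \<circ> T = (\<lambda>_. 0)" by auto
qed

lemma analyses_transformed_dsum:
  assumes "analyses A \<alpha>" "analyses B \<beta>" "invertible_op T" "invertible_op U"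
  shows "analyses (\<lambda>j. (A j \<circ> T) \<oplus>\<^sub>o (B j \<circ> U)) (\<lambda>z. \<alpha> (T (fst z)) + \<beta> (U (snd z)))"
  by (rule analyses_dsum [OF analyses_compose analyses_compose])
    (use assms in \<open>simp_all add: invertible_op_bounded_clinear\<close>)

lemma range_sum_fst_snd:
  "range (\<lambda>z. f (fst z) + g (snd z)) = {u + v | u v. u \<in> range f \<and> v \<in> range g}"
proof (intro equalityI subsetI)
  fix w assume "w \<in> {u + v | u v. u \<in> range f \<and> v \<in> range g}"
  then obtain x y where "w = f x + g y" by blast
  then show "w \<in> range (\<lambda>z. f (fst z) + g (snd z))" by (intro image_eqI [of _ _ "(x, y)"]) auto
qed auto

lemma disjoint_frames_iff:
  fixes A :: "'j \<Rightarrow> 'a::complex_hilbert \<Rightarrow> 'o::complex_hilbert"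
    and B :: "'j \<Rightarrow> 'b::complex_hilbert \<Rightarrow> 'o"
  assumes A: "ov_frame A" and B: "ov_frame B"
  shows "disjoint_frames A B \<longleftrightarrow>
      range (analysis_operator A) \<inter> range (analysis_operator B) = {0} \<and>
      closed {u + v | u v. u \<in> range (analysis_operator A) \<and> v \<in> range (analysis_operator B)}"
    (is "_ \<longleftrightarrow> range ?\<alpha> \<inter> range ?\<beta> = {0} \<and> _")
proof -
  have \<alpha>: "analyses A ?\<alpha>" and \<beta>: "analyses B ?\<beta>"
    by (rule ov_frame_analyses [OF A], rule ov_frame_analyses [OF B])
  note lin = analyses_clinear [OF \<alpha>] analyses_clinear [OF \<beta>]
  define W where "W z = ?\<alpha> (fst z) + ?\<beta> (snd z)" for z
  have W: "analyses (\<lambda>j. A j \<oplus>\<^sub>o B j) W"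
    using analyses_dsum [OF \<alpha> \<beta>] by (simp add: W_def [abs_def])
  have W_lin: "bounded_linear W"
    by (rule bounded_clinear_bounded_linear [OF analyses_clinear [OF W]])
  have W_pair: "W (x, y) = ?\<alpha> x + ?\<beta> y" for x y by (simp add: W_def)
  have range_W: "range W = {u + v | u v. u \<in> range ?\<alpha> \<and> v \<in> range ?\<beta>}"
    unfolding W_def [abs_def] by (rule range_sum_fst_snd)
  have inj_A: "inj ?\<alpha>"
    using A unfolding ov_frame_iff_bounded_below [OF \<alpha>] by (blast intro: bounded_below_inj [OF lin(1)])
  have inj_B: "inj ?\<beta>"
    using B unfolding ov_frame_iff_bounded_below [OF \<beta>] by (blast intro: bounded_below_inj [OF lin(2)])
  have zero: "?\<alpha> 0 = 0" "?\<beta> 0 = 0" using lin by (simp_all add: bounded_clinear_zero)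
  have "disjoint_frames A B \<longleftrightarrow> (\<exists>c>0. \<forall>z. c * norm z \<le> norm (W z))"
    unfolding disjoint_frames_def by (rule ov_frame_iff_bounded_below [OF W])
  also have "\<dots> \<longleftrightarrow> inj W \<and> closed (range W)"
  proof
    assume "\<exists>c>0. \<forall>z. c * norm z \<le> norm (W z)"
    then obtain c where c: "c > 0" "\<And>z. c * norm z \<le> norm (W z)" by blast
    have "complete (range W)"
      by (rule complete_isometric_image [OF c(1) subspace_UNIV W_lin _ complete_UNIV])
        (use c(2) in blast)
    then show "inj W \<and> closed (range W)"
      using bounded_below_inj [OF analyses_clinear [OF W] c] by (simp add: complete_eq_closed)
  next
    assume "inj W \<and> closed (range W)"
    then show "\<exists>c>0. \<forall>z. c * norm z \<le> norm (W z)"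
      using injective_closed_range_bounded_below [OF W_lin] by blast
  qed
  also have "inj W \<longleftrightarrow> range ?\<alpha> \<inter> range ?\<beta> = {0}"
  proof
    assume inj: "inj W"
    have "?\<alpha> x = 0" if "?\<alpha> x = ?\<beta> y" for x y
    proof -
      have "W (x, 0) = W (0, y)" by (simp add: W_pair zero that)
      then show ?thesis using injD [OF inj] zero by blast
    qed
    then show "range ?\<alpha> \<inter> range ?\<beta> = {0}"
      using zero by (auto simp: image_iff)
  next
    assume disj: "range ?\<alpha> \<inter> range ?\<beta> = {0}"
    show "inj W"
    proof (rule injI)
      fix z z' assume "W z = W z'"
      then have eq: "?\<alpha> (fst z - fst z') = ?\<beta> (snd z' - snd z)"
        by (simp add: W_def bounded_clinear_diff [OF lin(1)] bounded_clinear_diff [OF lin(2)]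
            algebra_simps)
      then have "?\<alpha> (fst z - fst z') \<in> range ?\<alpha> \<inter> range ?\<beta>" by (metis IntI rangeI)
      then have "?\<alpha> (fst z - fst z') = 0" using disj by blast
      then have "fst z - fst z' = 0" "snd z' - snd z = 0"
        using eq zero injD [OF inj_A] injD [OF inj_B] by metis+
      then show "z = z'" by (simp add: prod_eq_iff)
    qed
  qed
  finally show ?thesis by (simp only: range_W)
qed

lemma frame_normalizer:
  assumes C: "ov_frame C"
  shows "\<exists>T. invertible_op T \<and>
    (\<forall>x y. cinner (analysis_operator C (T x)) (analysis_operator C (T y)) = cinner x y)"
proof -
  have \<theta>: "analyses C (analysis_operator C)" by (rule ov_frame_analyses [OF C])
  obtain c where c: "c > 0" "\<And>x. c * norm x \<le> norm (analysis_operator C x)"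
    using C unfolding ov_frame_iff_bounded_below [OF \<theta>] by blast
  have "c\<^sup>2 > 0" using c(1) by simp
  from coercive_normalizer [OF bounded_clinear_frame_operator [OF \<theta>] this
      bounded_below_coercive [OF \<theta> c] frame_operator_symmetric [OF \<theta>]]
  show ?thesis by (simp add: cinner_frame_operator [OF \<theta>])
qed

text \<open>
  For orthogonal ranges, normalising each of the two frames by its own operator makes the sum
  isometric.
\<close>

lemma orthogonal_normalizers:
  assumes A: "ov_frame A" and B: "ov_frame B"
    and orth: "\<And>x y. cinner (analysis_operator A x) (analysis_operator B y) = 0"
  shows "\<exists>T U. invertible_op T \<and> invertible_op U \<and>
    parseval_frame (\<lambda>j. (A j \<circ> T) \<oplus>\<^sub>o (B j \<circ> U))"
proof -
  obtain T where T: "invertible_op T"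
    "\<And>x y. cinner (analysis_operator A (T x)) (analysis_operator A (T y)) = cinner x y"
    using frame_normalizer [OF A] by blast
  obtain U where U: "invertible_op U"
    "\<And>x y. cinner (analysis_operator B (U x)) (analysis_operator B (U y)) = cinner x y"
    using frame_normalizer [OF B] by blast
  have orth': "cinner (analysis_operator B y) (analysis_operator A x) = 0" for x y
    using orth [of x y] by (metis cinner_commute complex_cnj_zero)
  have "parseval_frame (\<lambda>j. (A j \<circ> T) \<oplus>\<^sub>o (B j \<circ> U))"
    unfolding parseval_frame_iff_isometric [OF analyses_transformed_dsum
        [OF ov_frame_analyses [OF A] ov_frame_analyses [OF B] T(1) U(1)]]
    by (simp add: cinner_add_left cinner_add_right cinner_prod_def T U orth orth')
  then show ?thesis using T(1) U(1) by blast
qed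

lemma parseval_dsum_orthogonal:
  fixes A :: "'j \<Rightarrow> 'a::complex_hilbert \<Rightarrow> 'o::complex_hilbert"
    and B :: "'j \<Rightarrow> 'b::complex_hilbert \<Rightarrow> 'o"
  assumes A: "ov_frame A" and B: "ov_frame B"
    and T: "invertible_op T" and U: "invertible_op U"
    and parseval: "parseval_frame (\<lambda>j. (A j \<circ> T) \<oplus>\<^sub>o (B j \<circ> U))"
  shows "cinner (analysis_operator A x) (analysis_operator B y) = 0"
proof -
  have \<alpha>: "analyses A (analysis_operator A)" and \<beta>: "analyses B (analysis_operator B)"
    by (rule ov_frame_analyses [OF A], rule ov_frame_analyses [OF B])
  note zero = bounded_clinear_zero [OF analyses_clinear [OF \<alpha>]]
    bounded_clinear_zero [OF analyses_clinear [OF \<beta>]]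
    bounded_clinear_zero [OF invertible_op_bounded_clinear [OF T]]
    bounded_clinear_zero [OF invertible_op_bounded_clinear [OF U]]
  let ?W = "\<lambda>z. analysis_operator A (T (fst z)) + analysis_operator B (U (snd z))"
  have "cinner (?W (inv T x, 0)) (?W (0, inv U y)) = cinner (inv T x, 0) (0, inv U y)"
    using parseval unfolding parseval_frame_iff_isometric
      [OF analyses_transformed_dsum [OF \<alpha> \<beta> T U]] by blast
  then show ?thesis
    by (simp add: zero inverse_op [OF T] inverse_op [OF U] cinner_prod_def)
qed

lemma strongly_disjoint_frames_iff_orthogonal:
  assumes "ov_frame A" "ov_frame B"
  shows "strongly_disjoint_frames A B \<longleftrightarrow>
    (\<forall>x y. cinner (analysis_operator A x) (analysis_operator B y) = 0)"
  unfolding strongly_disjoint_frames_def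
  using parseval_dsum_orthogonal [OF assms] orthogonal_normalizers [OF assms] by blast

lemma frame_projections_comp_eq_zero_iff:
  assumes A: "ov_frame A" and B: "ov_frame B"
  shows "frame_projection A \<circ> frame_projection B = (\<lambda>_. 0) \<longleftrightarrow>
    cadjoint (analysis_operator A) \<circ> analysis_operator B = (\<lambda>_. 0)"
proof -
  have "frame_projection A \<circ> frame_projection B = (\<lambda>_. 0) \<longleftrightarrow>
      (\<forall>v\<in>range (frame_projection B). frame_projection A v = 0)"
    by (auto simp: fun_eq_iff)
  also have "\<dots> \<longleftrightarrow> (\<forall>v\<in>range (analysis_operator B). cadjoint (analysis_operator A) v = 0)"
    by (simp only: range_frame_projection [OF B] frame_projection_eq_zero_iff [OF A])
  finally show ?thesis by (auto simp: fun_eq_iff)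
qed

lemma strongly_complementary_frames_iff:
  assumes A: "ov_frame A" and B: "ov_frame B"
  shows "strongly_complementary_frames A B \<longleftrightarrow>
    (\<forall>x y. cinner (analysis_operator A x) (analysis_operator B y) = 0) \<and>
    (\<forall>v. \<exists>x y. v = analysis_operator A x + analysis_operator B y)"
    (is "_ \<longleftrightarrow> ?orth \<and> ?span")
proof -
  have "surj (\<lambda>z. analysis_operator A (T (fst z)) + analysis_operator B (U (snd z))) \<longleftrightarrow> ?span"
    if T: "invertible_op T" and U: "invertible_op U" for T U
  proof
    assume surj: "surj (\<lambda>z. analysis_operator A (T (fst z)) + analysis_operator B (U (snd z)))"
    show ?span
    proof
      fix v
      from surjD [OF surj] show "\<exists>x y. v = analysis_operator A x + analysis_operator B y" by blast
    qed
  next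
    assume span: ?span
    show "surj (\<lambda>z. analysis_operator A (T (fst z)) + analysis_operator B (U (snd z)))"
      unfolding surj_def
    proof
      fix v
      obtain x y where "v = analysis_operator A x + analysis_operator B y" using span by blast
      then show "\<exists>z. v = analysis_operator A (T (fst z)) + analysis_operator B (U (snd z))"
        by (intro exI [of _ "(inv T x, inv U y)"]) (simp add: inverse_op [OF T] inverse_op [OF U])
    qed
  qed
  then have "strongly_complementary_frames A B \<longleftrightarrow> strongly_disjoint_frames A B \<and> ?span"
    unfolding strongly_complementary_frames_def strongly_disjoint_frames_def
    using orthonormal_frame_iff_unitary [OF analyses_transformed_dsum
        [OF ov_frame_analyses [OF A] ov_frame_analyses [OF B]]]
    by (metis (no_types, lifting))
  then show ?thesis
    by (simp add: strongly_disjoint_frames_iff_orthogonal [OF A B])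
qed

lemma frame_projections_sum_eq_id_iff:
  assumes A: "ov_frame A" and B: "ov_frame B"
  shows "(\<lambda>v. frame_projection A v + frame_projection B v) = id \<longleftrightarrow>
    (\<forall>x y. cinner (analysis_operator A x) (analysis_operator B y) = 0) \<and>
    (\<forall>v. \<exists>x y. v = analysis_operator A x + analysis_operator B y)"
    (is "?sum = id \<longleftrightarrow> ?orth \<and> ?span")
proof -
  let ?\<alpha> = "analysis_operator A" and ?\<beta> = "analysis_operator B"
  have \<alpha>: "bounded_clinear ?\<alpha>" and \<beta>: "bounded_clinear ?\<beta>"
    using A B by (auto intro: analyses_clinear ov_frame_analyses)
  show ?thesis
  proof
    assume sum: "?sum = id"
    have v: "v = frame_projection A v + frame_projection B v" for v
      using fun_cong [OF sum, of v] by simp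
    have "frame_projection A (?\<beta> y) = 0" for y
      using v [of "?\<beta> y"] by (simp add: frame_projection_analysis [OF B])
    then have ?orth by (simp add: frame_projection_kernel [OF A])
    moreover have ?span
    proof
      fix v
      have "frame_projection A v \<in> range ?\<alpha>" "frame_projection B v \<in> range ?\<beta>"
        by (simp_all flip: range_frame_projection [OF A] range_frame_projection [OF B])
      then show "\<exists>x y. v = ?\<alpha> x + ?\<beta> y" using v [of v] by (metis rangeE)
    qed
    ultimately show "?orth \<and> ?span" ..
  next
    assume *: "?orth \<and> ?span"
    then have "cinner (?\<beta> y) (?\<alpha> x) = 0" for x y
      by (metis cinner_commute complex_cnj_zero)
    then have zero: "frame_projection A (?\<beta> y) = 0" "frame_projection B (?\<alpha> x) = 0" for x y
      using * by (simp_all add: frame_projection_kernel [OF A] frame_projection_kernel [OF B])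
    have "frame_projection A v + frame_projection B v = v" for v
    proof -
      obtain x y where "v = ?\<alpha> x + ?\<beta> y" using * by blast
      then show ?thesis
        by (simp add: frame_projection_add [OF A] frame_projection_add [OF B] zero
            frame_projection_analysis [OF A] frame_projection_analysis [OF B])
    qed
    then show "?sum = id" by auto
  qed
qed

theorem proposition5p7:
  fixes A :: "'j \<Rightarrow> 'a::complex_hilbert \<Rightarrow> 'o::complex_hilbert"
    and B :: "'j \<Rightarrow> 'b::complex_hilbert \<Rightarrow> 'o"
  assumes "ov_frame A" and "ov_frame B"
  shows
    "(disjoint_frames A B \<longleftrightarrow>
        range (frame_projection A) \<inter> range (frame_projection B) = {0} \<and>
        closed {u + v | u v. u \<in> range (frame_projection A) \<and> v \<in> range (frame_projection B)}) \<and>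
     ((strongly_disjoint_frames A B \<longleftrightarrow>
         frame_projection A \<circ> frame_projection B = (\<lambda>_. 0)) \<and>
      (strongly_disjoint_frames A B \<longleftrightarrow>
         cadjoint (analysis_operator A) \<circ> analysis_operator B = (\<lambda>_. 0)) \<and>
      (strongly_disjoint_frames A B \<longleftrightarrow>
         cadjoint (analysis_operator B) \<circ> analysis_operator A = (\<lambda>_. 0))) \<and>
     (strongly_complementary_frames A B \<longleftrightarrow>
        (\<lambda>v. frame_projection A v + frame_projection B v) = id)"
proof -
  have \<alpha>: "bounded_clinear (analysis_operator A)" and \<beta>: "bounded_clinear (analysis_operator B)"
    using assms by (auto intro: analyses_clinear ov_frame_analyses)
  have sym: "cinner u v = 0 \<longleftrightarrow> cinner v u = 0" for u v :: "('j, 'o) ell2"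
    by (metis cinner_commute complex_cnj_zero)
  have AB: "strongly_disjoint_frames A B \<longleftrightarrow>
      cadjoint (analysis_operator A) \<circ> analysis_operator B = (\<lambda>_. 0)"
    by (simp only: strongly_disjoint_frames_iff_orthogonal [OF assms]
        cadjoint_comp_eq_zero_iff [OF \<alpha>])
  moreover have "strongly_disjoint_frames A B \<longleftrightarrow>
      cadjoint (analysis_operator B) \<circ> analysis_operator A = (\<lambda>_. 0)"
    unfolding strongly_disjoint_frames_iff_orthogonal [OF assms] cadjoint_comp_eq_zero_iff [OF \<beta>]
    using sym by blast
  moreover have "strongly_disjoint_frames A B \<longleftrightarrow>
      frame_projection A \<circ> frame_projection B = (\<lambda>_. 0)"
    by (simp only: AB frame_projections_comp_eq_zero_iff [OF assms])
  moreover have "strongly_complementary_frames A B \<longleftrightarrow>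
      (\<lambda>v. frame_projection A v + frame_projection B v) = id"
    by (simp only: strongly_complementary_frames_iff [OF assms]
        frame_projections_sum_eq_id_iff [OF assms])
  moreover have "disjoint_frames A B \<longleftrightarrow>
      range (frame_projection A) \<inter> range (frame_projection B) = {0} \<and>
      closed {u + v | u v. u \<in> range (frame_projection A) \<and> v \<in> range (frame_projection B)}"
    unfolding disjoint_frames_iff [OF assms] range_frame_projection [OF assms(1)]
      range_frame_projection [OF assms(2)] by (rule refl)
  ultimately show ?thesis by blast
qed

end
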